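(* Let $\theta>0$ and let $s:[0,\infty)\to[0,\infty)$ be locally absolutely continuous on $[0,\infty)$, strictly increasing with $s(0)=0$ and $s(1)=1$, satisfying $s(x+1)\le s(x)+1$ for all $x\ge0$ and $|s(x+1)-s(y+1)|\le|s(x)-s(y)|$ for all $x,y\ge0$, and such that $E[D_{\theta,s}]<\infty$. Let $\{U_n,n\ge0\}$ be i.i.d. $\mathcal{U}[0,1]$ random variables, let $W_0$ be a non-negative random variable with $E[W_0]<\infty$, independent of $\{U_n,n\ge0\}$, and let $$W_{n+1}=s^{-1}\big(U_n^{1/\theta}s(W_n+1)\big)\quad\text{for }n\ge0.$$ Suppose there exists $\rho\in[0,1)$ such that $\|I\|_\infty\le\rho$, where $I(x)=\frac{\theta s'(x)}{s^{\theta+1}(x)}\int_0^xs^\theta(v)\,dv$ for $x>0$ such that $s'(x)$ exists. Then for all $n\ge 0$ $$d_1(W_n,D_{\theta,s})\le(1-\rho)^{-1}d_1(W_{n+1},W_n).$$ Moreover, if $s$ satisfies $$|s^{-1}(as(x))-s^{-1}(as(y))|\le a|x-y|\quad\text{for all }a\in[0,1]\text{ and }x,y\ge1,$$ then for all $n\ge 0$ $$d_1(W_n,D_{\theta,s})\le(1-\rho)^{-1}\Big(\frac{\theta}{\theta+1}\Big)^nd_1(W_1,W_0),$$ and, when $W_0=0$, $$d_1(W_n,D_{\theta,s})\le(1-\rho)^{-1}\Big(\frac{\theta}{\theta+1}\Big)^nE[s^{-1}(U^{1/\theta})],\qquad U\sim\mathcal{U}[0,1].$$ In particular, in the case of the generalized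 Dickman family $\mathcal{D}_\theta$ (that is, $s(x)=x$, with $W_0=0$), $$d_1(W_n,D_\theta)\le\theta\Big(\frac{\theta}{\theta+1}\Big)^n.$$
   Context: $=_d$ denotes equality in distribution; $\|\cdot\|_\infty$ is the essential supremum norm with respect to Lebesgue measure (over $x>0$). A function on $[0,\infty)$ is locally absolutely continuous if it is absolutely continuous on every compact subinterval. $D_{\theta,s}$ denotes a random variable whose law $\mathcal{D}_{\theta,s}$ is the unique law of a non-negative random variable $D$ such that $s(D)$ has finite mean and $D=_ds^{-1}(U^{1/\theta}s(D+1))$ with $U\sim\mathcal{U}[0,1]$ independent of $D$ (this law exists and is unique under the stated conditions on $s$). For $s(x)=x$ this is the generalized Dickman distribution $\mathcal{D}_\theta$, the unique law of a non-negative $W$ with $W=_dU^{1/\theta}(W+1)$; $D_\theta$ denotes a variable with this law. The Wasserstein distance is $d_1(X,Y)=\sup_{h}|Eh(X)-Eh(Y)|$ over all $h$ with $|h(x)-h(y)|\le|x-y|$; equivalently $d_1(X,Y)=\inf E|X-Y|$ over all joint distributions with the given marginals. *)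

theory Defs
  imports "HOL-Probability.Probability"
begin

text \<open>The usual epsilon-delta notion for functions; the constant \<^const>\<open>absolutely_continuous\<close>
  of the library is the unrelated notion for measures.\<close>

definition abs_cont_on_interval :: "real \<Rightarrow> real \<Rightarrow> (real \<Rightarrow> real) \<Rightarrow> bool" where
  "abs_cont_on_interval a b f \<longleftrightarrow>
     (\<forall>\<epsilon>>0. \<exists>\<delta>>0. \<forall>P :: (real \<times> real) set.
        finite P \<and> (\<forall>(u, v)\<in>P. a \<le> u \<and> u < v \<and> v \<le> b) \<and>
        disjoint_family_on (\<lambda>(u, v). {u<..<v}) P \<and> (\<Sum>(u, v)\<in>P. v - u) < \<delta>
        \<longrightarrow> (\<Sum>(u, v)\<in>P. \<bar>f v - f u\<bar>) < \<epsilon>)"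

definition locally_abs_cont :: "(real \<Rightarrow> real) \<Rightarrow> bool" where
  "locally_abs_cont f \<longleftrightarrow> (\<forall>a b. 0 \<le> a \<and> a \<le> b \<longrightarrow> abs_cont_on_interval a b f)"

text \<open>Functions on the half-line are total functions on the reals whose values at negative
  arguments are unconstrained and never used.\<close>

definition dickman_utility :: "(real \<Rightarrow> real) \<Rightarrow> bool" where
  "dickman_utility s \<longleftrightarrow>
     s \<in> {0..} \<rightarrow> {0..} \<and> locally_abs_cont s \<and> strict_mono_on {0..} s \<and> s 0 = 0 \<and> s 1 = 1 \<and>
     (\<forall>x\<ge>0. s (x + 1) \<le> s x + 1) \<and>
     (\<forall>x\<ge>0. \<forall>y\<ge>0. \<bar>s (x + 1) - s (y + 1)\<bar> \<le> \<bar>s x - s y\<bar>)"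

abbreviation unif01 :: "real measure" where
  "unif01 \<equiv> uniform_measure lborel {0..1}"

text \<open>For \<open>u\<close> in the unit interval and \<open>x \<ge> 0\<close> the argument of the inverse lies between \<open>0\<close> and
  \<open>s (x + 1)\<close>, hence in the range of the continuous function \<open>s\<close>.\<close>

definition dickman_step :: "real \<Rightarrow> (real \<Rightarrow> real) \<Rightarrow> real \<Rightarrow> real \<Rightarrow> real" where
  "dickman_step \<theta> s u x = inv_into {0..} s (u powr (1 / \<theta>) * s (x + 1))"

text \<open>The random variable \<open>D\<close> on \<open>N\<close> has the law \<open>\<D>\<^bsub>\<theta>,s\<^esub>\<close>. The law of the right-hand side of
  the distributional equation, for \<open>U\<close> independent of \<open>D\<close>, is computed on the product space.\<close>

definition has_dickman_law :: "real \<Rightarrow> (real \<Rightarrow> real) \<Rightarrow> 'b measure \<Rightarrow> ('b \<Rightarrow> real) \<Rightarrow> bool" where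
  "has_dickman_law \<theta> s N D \<longleftrightarrow>
     prob_space N \<and> D \<in> borel_measurable N \<and> (\<forall>\<omega>\<in>space N. 0 \<le> D \<omega>) \<and>
     integrable N (\<lambda>\<omega>. s (D \<omega>)) \<and>
     distr N borel D = distr (unif01 \<Otimes>\<^sub>M N) borel (\<lambda>(u, \<omega>). dickman_step \<theta> s u (D \<omega>))"

text \<open>The generalized Dickman distribution \<open>\<D>\<^bsub>\<theta>\<^esub>\<close>, characterized without a moment condition.\<close>

definition has_generalized_dickman_law :: "real \<Rightarrow> 'b measure \<Rightarrow> ('b \<Rightarrow> real) \<Rightarrow> bool" where
  "has_generalized_dickman_law \<theta> N D \<longleftrightarrow>
     prob_space N \<and> D \<in> borel_measurable N \<and> (\<forall>\<omega>\<in>space N. 0 \<le> D \<omega>) \<and>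
     distr N borel D = distr (unif01 \<Otimes>\<^sub>M N) borel (\<lambda>(u, \<omega>). u powr (1 / \<theta>) * (D \<omega> + 1))"

definition dickman_chain ::
  "real \<Rightarrow> (real \<Rightarrow> real) \<Rightarrow> 'a measure \<Rightarrow> (nat \<Rightarrow> 'a \<Rightarrow> real) \<Rightarrow> (nat \<Rightarrow> 'a \<Rightarrow> real) \<Rightarrow> bool" where
  "dickman_chain \<theta> s M U W \<longleftrightarrow>
     prob_space M \<and>
     prob_space.indep_vars M (\<lambda>_. borel) U UNIV \<and>
     (\<forall>n. distr M borel (U n) = unif01) \<and>
     W 0 \<in> borel_measurable M \<and>
     prob_space.indep_set M
       (sets (vimage_algebra (space M) (W 0) borel))
       (sets (vimage_algebra (space M) (\<lambda>\<omega> n. U n \<omega>) (PiM UNIV (\<lambda>_. borel)))) \<and>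
     (\<forall>\<omega>\<in>space M. 0 \<le> W 0 \<omega>) \<and> integrable M (W 0) \<and>
     (\<forall>n. \<forall>\<omega>\<in>space M. W (Suc n) \<omega> = dickman_step \<theta> s (U n \<omega>) (W n \<omega>))"

text \<open>A distance between laws on the real line with finite mean, for which every 1-Lipschitz
  function is integrable.\<close>

definition wasserstein1 :: "real measure \<Rightarrow> real measure \<Rightarrow> ennreal" where
  "wasserstein1 \<mu> \<nu> =
     (SUP h \<in> {h :: real \<Rightarrow> real. 1-lipschitz_on UNIV h}. ennreal \<bar>(\<integral>x. h x \<partial>\<mu>) - (\<integral>x. h x \<partial>\<nu>)\<bar>)"

abbreviation d1 :: "'a measure \<Rightarrow> ('a \<Rightarrow> real) \<Rightarrow> 'b measure \<Rightarrow> ('b \<Rightarrow> real) \<Rightarrow> ennreal" where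
  "d1 M X N Y \<equiv> wasserstein1 (distr M borel X) (distr N borel Y)"

text \<open>Where \<open>s\<close> is not differentiable the value is irrelevant: by local absolute continuity these
  points form a null set.\<close>

definition dickman_I :: "real \<Rightarrow> (real \<Rightarrow> real) \<Rightarrow> real \<Rightarrow> real" where
  "dickman_I \<theta> s x =
     \<theta> * deriv s x / (s x powr (\<theta> + 1)) * integral {0..x} (\<lambda>v. s v powr \<theta>)"

definition sup_norm_pos :: "(real \<Rightarrow> real) \<Rightarrow> ereal" where
  "sup_norm_pos f = esssup (restrict_space lebesgue {0<..}) (\<lambda>x. ereal \<bar>f x\<bar>)"

end

theory Submission
  imports Defs
begin

text \<open>Let \<open>A \<mu>\<close> be the law of \<open>s\<^sup>-\<^sup>1(U\<^bsup>1/\<theta>\<^esup> s(X + 1))\<close> for \<open>X\<close> with law \<open>\<mu>\<close> and an independent uniform \<open>U\<close>.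
The laws of the chain are the iterates of \<open>A\<close>, and the Dickman law is a fixed point of \<open>A\<close>. All
four bounds are instances of Banach's fixed point argument for the Wasserstein distance: if \<open>A\<close>
contracts distances by a factor \<open>L < 1\<close>, then \<open>d(\<mu>, \<pi>) \<le> d(\<mu>, A \<mu>) + L d(\<mu>, \<pi>)\<close> for the fixed point
\<open>\<pi>\<close> (\<open>fixed_point_bound\<close>), and successive iterates approach each other geometrically.

It suffices to bound \<open>E|s\<^sup>-\<^sup>1(U\<^bsup>1/\<theta>\<^esup> s(x + 1)) - s\<^sup>-\<^sup>1(U\<^bsup>1/\<theta>\<^esup> s(y + 1))|\<close> by \<open>L |x - y|\<close>, where the two
sides share the same \<open>U\<close> (\<open>advance_contraction\<close>). The map is increasing in \<open>x\<close>, so this expectation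
is a difference of two values of the function \<open>x \<mapsto> E s\<^sup>-\<^sup>1(U\<^bsup>1/\<theta>\<^esup> s(x))\<close>. By Tonelli this function
equals \<open>x - s(x)\<^bsup>-\<theta>\<^esup> \<integral>\<^sub>0\<^sup>x s\<^sup>\<theta>\<close> (\<open>average_eq_averaged_id\<close>), and its derivative is exactly \<open>I(x)\<close>
(\<open>averaged_id_derivative\<close>). Hence \<open>|I| \<le> \<rho>\<close> almost everywhere gives \<open>L = \<rho>\<close>
(\<open>step_contraction\<close>), and the Lipschitz condition on \<open>s\<^sup>-\<^sup>1\<close> gives \<open>L = E U\<^bsup>1/\<theta>\<^esup> = \<theta> / (\<theta> + 1)\<close>
directly (\<open>step_contraction_lipschitz\<close>).

To pass from the derivative to increments one needs that the continuous monotone function \<open>s\<close> is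
differentiable almost everywhere (\<open>negligible_not_differentiable_mono\<close>, by two applications of
Vitali's covering theorem), and that an absolutely continuous function whose derivative is at most
\<open>\<rho>\<close> almost everywhere grows at most like \<open>\<rho> x\<close> (\<open>abs_cont_increment_le\<close>, by a gauge argument).

For \<open>s(x) = x\<close> the factor \<open>\<theta> / (\<theta> + 1)\<close> also serves as \<open>\<rho>\<close>, with \<open>(1 - \<rho>)\<^sup>-\<^sup>1 = \<theta> + 1\<close>. The
generalized Dickman law is given without a moment condition, so the finiteness of its mean has to be
derived from stationarity (\<open>generalized_dickman_finite_mean\<close>).\<close>

section \<open>Differentiability of continuous monotone functions\<close>

lemma emeasure_interval_measure_Ioo:
  assumes "u \<le> v" and mono: "\<And>x y. x \<le> y \<Longrightarrow> F x \<le> F y" and cont: "continuous_on UNIV F"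
  shows "emeasure (interval_measure F) {u<..<v} = ennreal (F v - F u)"
proof -
  have rc: "continuous (at_right a) F" for a
    using cont by (simp add: continuous_on_eq_continuous_at continuous_at_imp_continuous_at_within)
  have "{v} \<in> null_sets (interval_measure F)"
    using emeasure_interval_measure_Icc[of v v F] mono cont by (auto intro!: null_setsI)
  then have "emeasure (interval_measure F) ({u<..v} - {v}) = emeasure (interval_measure F) {u<..v}"
    by (intro emeasure_Diff_null_set) auto
  moreover have "{u<..v} - {v} = {u<..<v}" by auto
  ultimately show ?thesis
    using emeasure_interval_measure_Ioc[OF assms(1) mono rc] by simp
qed

text \<open>The Vitali covering theorem for an arbitrary property \<open>Q\<close> of intervals. Its closed balls are replaced
by open intervals at the price of countably many end points, so that the selected intervals have an
open union, inside which the theorem can be applied a second time.\<close>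

lemma vitali_open_intervals:
  fixes E T :: "real set"
  assumes T: "open T" "E \<subseteq> T"
    and Q: "\<And>x d. x \<in> E \<Longrightarrow> 0 < d \<Longrightarrow> \<exists>u v. u < v \<and> v - u < d \<and> x \<in> {u..v} \<and> Q u v"
  obtains C :: "(real \<times> real) set" where "countable C"
    "\<forall>u v. (u, v) \<in> C \<longrightarrow> u < v \<and> Q u v \<and> {u<..<v} \<subseteq> T"
    "disjoint_family_on (\<lambda>(u, v). {u<..<v}) C"
    "negligible (E - (\<Union>(u, v)\<in>C. {u<..<v}))"
proof -
  define K where "K = {(u, v). u < v \<and> Q u v \<and> {u..v} \<subseteq> T}"
  define a where "a = (\<lambda>(u::real, v). (u + v) / 2)"
  define r where "r = (\<lambda>(u::real, v). (v - u) / 2)"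
  have cball_ar: "cball (a i) (r i) = {fst i..snd i}" for i
    by (cases i) (auto simp: a_def r_def cball_eq_atLeastAtMost field_simps)
  have "\<exists>i. i \<in> K \<and> x \<in> cball (a i) (r i) \<and> r i < d" if xd: "x \<in> E" "0 < d" for x d
  proof -
    obtain e where e: "e > 0" "ball x e \<subseteq> T"
      using T \<open>x \<in> E\<close> by (meson openE subsetD)
    obtain u v where uv: "u < v" "v - u < min e d" "x \<in> {u..v}" "Q u v"
      using Q[OF xd(1), of "min e d"] xd e by (metis min_less_iff_conj)
    have "{u..v} \<subseteq> ball x e" using uv by (auto simp: dist_real_def)
    then have "(u, v) \<in> K" using uv e by (auto simp: K_def)
    then show ?thesis using uv cball_ar[of "(u, v)"]
      by (intro exI[of _ "(u, v)"]) (auto simp: r_def)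
  qed
  moreover have "0 < r i" if "i \<in> K" for i using that by (auto simp: K_def r_def)
  ultimately obtain C where C: "countable C" "C \<subseteq> K"
     "pairwise (\<lambda>i j. disjnt (cball (a i) (r i)) (cball (a j) (r j))) C"
     "negligible(E - (\<Union>i \<in> C. cball (a i) (r i)))"
    using Vitali_covering_theorem_cballs[of K r E a] by blast
  have ends: "negligible (\<Union>i\<in>C. {fst i, snd i})"
    using C(1) by (intro negligible_countable_Union) auto
  show ?thesis
  proof (rule that[of C])
    show "negligible (E - (\<Union>(u, v)\<in>C. {u<..<v}))"
    proof (rule negligible_subset[OF negligible_Un[OF C(4) ends]])
      show "E - (\<Union>(u, v)\<in>C. {u<..<v}) \<subseteq> E - (\<Union>i\<in>C. cball (a i) (r i)) \<union> (\<Union>i\<in>C. {fst i, snd i})"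
        unfolding cball_ar by force
    qed
    show "disjoint_family_on (\<lambda>(u, v). {u<..<v}) C"
      using C(3) unfolding cball_ar disjoint_family_on_def pairwise_def disjnt_def by fastforce
    show "\<forall>u v. (u, v) \<in> C \<longrightarrow> u < v \<and> Q u v \<and> {u<..<v} \<subseteq> T"
      using C(2) by (force simp: K_def)
  qed (fact C(1))
qed

lemma emeasure_disjoint_intervals_mono:
  assumes "countable C" and disj: "disjoint_family_on (\<lambda>(u, v). {u<..<v}) C"
    and sets [measurable_cong]: "sets \<mu> = sets borel" "sets \<nu> = sets borel"
    and le: "\<And>u v. (u, v) \<in> C \<Longrightarrow> emeasure \<mu> {u<..<v::real} \<le> emeasure \<nu> {u<..<v}"
  shows "emeasure \<mu> (\<Union>(u, v)\<in>C. {u<..<v}) \<le> emeasure \<nu> (\<Union>(u, v)\<in>C. {u<..<v})"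
proof -
  have "emeasure \<mu> (\<Union>(u, v)\<in>C. {u<..<v}) = (\<integral>\<^sup>+i. emeasure \<mu> (case i of (u, v) \<Rightarrow> {u<..<v}) \<partial>count_space C)"
    using assms(1) disj by (intro emeasure_UN_countable) (auto simp: sets)
  also have "\<dots> \<le> (\<integral>\<^sup>+i. emeasure \<nu> (case i of (u, v) \<Rightarrow> {u<..<v}) \<partial>count_space C)"
    using le by (intro nn_integral_mono) auto
  also have "\<dots> = emeasure \<nu> (\<Union>(u, v)\<in>C. {u<..<v})"
    using assms(1) disj by (intro emeasure_UN_countable[symmetric]) (auto simp: sets)
  finally show ?thesis .
qed

text \<open>With an outer measure, no measurability has to be established for the sets of points at which a
difference quotient oscillates.\<close>

definition outer_length :: "real set \<Rightarrow> ennreal" where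
  "outer_length E = (INF T\<in>{T. open T \<and> E \<subseteq> T}. emeasure lborel T)"

lemma outer_length_le_up_to_negligible:
  assumes "open T" "negligible (E - T)"
  shows "outer_length E \<le> emeasure lborel T"
proof (rule ennreal_le_epsilon)
  fix e :: real assume "0 < e"
  have null: "E - T \<in> null_sets lebesgue" using assms(2) negligible_iff_null_sets by blast
  then have "E - T \<in> sets lebesgue" by auto
  from sets_lebesgue_outer_open[OF this \<open>0 < e\<close>] obtain V where V: "open V" "E - T \<subseteq> V"
    "emeasure lebesgue (V - (E - T)) < ennreal e" by metis
  have "emeasure lebesgue V = emeasure lebesgue (V - (E - T))"
    using null V by (intro emeasure_Diff_null_set[symmetric]) auto
  then have "emeasure lborel V \<le> ennreal e" using V by simp
  have "outer_length E \<le> emeasure lborel (T \<union> V)"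
    unfolding outer_length_def using V assms by (intro INF_lower) auto
  also have "\<dots> \<le> emeasure lborel T + emeasure lborel V"
    using V assms by (intro emeasure_subadditive) auto
  also have "\<dots> \<le> emeasure lborel T + ennreal e"
    using \<open>emeasure lborel V \<le> ennreal e\<close> by (intro add_left_mono) auto
  finally show "outer_length E \<le> emeasure lborel T + ennreal e" .
qed

lemma negligible_outer_length_0:
  assumes "outer_length E = 0"
  shows "negligible E"
  unfolding negligible_outer
proof (intro allI impI)
  fix e :: real assume "0 < e"
  then have "outer_length E < ennreal e" using assms by simp
  then obtain T where T: "open T" "E \<subseteq> T" "emeasure lborel T < ennreal e"
    unfolding outer_length_def by (auto simp: INF_less_iff)
  then have "T \<in> lmeasurable"
    by (intro fmeasurableI) (auto simp: order_less_trans)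
  moreover have "measure lebesgue T < e"
  proof -
    have "emeasure lebesgue T = ennreal (measure lebesgue T)"
      using \<open>T \<in> lmeasurable\<close> by (simp add: emeasure_eq_measure2)
    then have "ennreal (measure lebesgue T) < ennreal e" using T by simp
    then show ?thesis by (simp add: ennreal_less_iff)
  qed
  ultimately show "\<exists>T. E \<subseteq> T \<and> T \<in> lmeasurable \<and> measure lebesgue T < e"
    using T by blast
qed

context
  fixes F :: "real \<Rightarrow> real"
  assumes mono: "\<And>x y. x \<le> y \<Longrightarrow> F x \<le> F y" and cont: "continuous_on UNIV F"
begin

text \<open>A Vitali family of intervals on which \<open>F\<close> grows by at least the factor \<open>q\<close> can be chosen disjoint
and inside \<open>T\<close>, and the Stieltjes measure of \<open>F\<close> adds up their increments.\<close>

lemma outer_length_steep: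
  assumes "open T" "E \<subseteq> T" "0 \<le> q"
    and steep: "\<And>x d. x \<in> E \<Longrightarrow> 0 < d \<Longrightarrow> \<exists>u v. u < v \<and> v - u < d \<and> x \<in> {u..v} \<and> q * (v - u) \<le> F v - F u"
  shows "ennreal q * outer_length E \<le> emeasure (interval_measure F) T"
proof -
  let ?\<mu> = "interval_measure F"
  obtain C :: "(real \<times> real) set" where C: "countable C"
    "\<forall>u v. (u, v) \<in> C \<longrightarrow> u < v \<and> q * (v - u) \<le> F v - F u \<and> {u<..<v} \<subseteq> T"
    "disjoint_family_on (\<lambda>(u, v). {u<..<v}) C"
    "negligible (E - (\<Union>(u, v)\<in>C. {u<..<v}))"
    by (rule vitali_open_intervals[OF assms(1,2), of "\<lambda>u v. q * (v - u) \<le> F v - F u", OF steep])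
  define V where "V = (\<Union>(u, v)\<in>C. {u<..<v})"
  have V: "open V" "V \<subseteq> T" using C(2) by (auto simp: V_def)
  have "ennreal q * outer_length E \<le> ennreal q * emeasure lborel V"
    using C(4) V by (intro mult_left_mono outer_length_le_up_to_negligible) (auto simp: V_def)
  also have "\<dots> = emeasure (scale_measure (ennreal q) lborel) V" by simp
  also have "\<dots> \<le> emeasure ?\<mu> V" unfolding V_def
  proof (rule emeasure_disjoint_intervals_mono[OF C(1,3)])
    fix u v assume "(u, v) \<in> C"
    then have "u < v" "q * (v - u) \<le> F v - F u" using C(2) by auto
    then show "emeasure (scale_measure (ennreal q) lborel) {u<..<v} \<le> emeasure ?\<mu> {u<..<v}"
      using emeasure_interval_measure_Ioo[OF _ mono cont, of u v]
        ennreal_leI[of "q * (v - u)" "F v - F u"] assms(3)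
      by (simp add: ennreal_mult)
  qed auto
  also have "\<dots> \<le> emeasure ?\<mu> T" using V assms by (intro emeasure_mono) auto
  finally show ?thesis .
qed

text \<open>The same selection for slow growth. The open set \<open>V\<close> is the union of the chosen intervals; it is
returned as an object because the intervals of fast growth are to be chosen inside it.\<close>

lemma shallow_cover:
  assumes "open T" "E \<subseteq> T" "0 \<le> p"
    and shallow: "\<And>x d. x \<in> E \<Longrightarrow> 0 < d \<Longrightarrow> \<exists>u v. u < v \<and> v - u < d \<and> x \<in> {u..v} \<and> F v - F u \<le> p * (v - u)"
  obtains V where "open V" "V \<subseteq> T" "negligible (E - V)"
    "emeasure (interval_measure F) V \<le> ennreal p * emeasure lborel T"
proof -
  let ?\<mu> = "interval_measure F"
  obtain C :: "(real \<times> real) set" where C: "countable C"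
    "\<forall>u v. (u, v) \<in> C \<longrightarrow> u < v \<and> F v - F u \<le> p * (v - u) \<and> {u<..<v} \<subseteq> T"
    "disjoint_family_on (\<lambda>(u, v). {u<..<v}) C"
    "negligible (E - (\<Union>(u, v)\<in>C. {u<..<v}))"
    by (rule vitali_open_intervals[OF assms(1,2), where Q = "\<lambda>u v. F v - F u \<le> p * (v - u)"],
        rule shallow, assumption, assumption)
  define V where "V = (\<Union>(u, v)\<in>C. {u<..<v})"
  have V: "open V" "V \<subseteq> T" using C(2) by (auto simp: V_def)
  have "emeasure ?\<mu> V \<le> emeasure (scale_measure (ennreal p) lborel) V" unfolding V_def
  proof (rule emeasure_disjoint_intervals_mono[OF C(1,3)])
    fix u v assume "(u, v) \<in> C"
    then have "u < v" "F v - F u \<le> p * (v - u)" using C(2) by auto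
    then show "emeasure ?\<mu> {u<..<v} \<le> emeasure (scale_measure (ennreal p) lborel) {u<..<v}"
      using emeasure_interval_measure_Ioo[OF _ mono cont, of u v]
        ennreal_leI[of "F v - F u" "p * (v - u)"] assms(3)
      by (simp add: ennreal_mult)
  qed auto
  also have "\<dots> \<le> ennreal p * emeasure lborel T"
    using V assms(1) by (simp add: mult_left_mono emeasure_mono)
  finally show ?thesis using that[OF V] C(4) by (simp add: V_def)
qed

text \<open>Let \<open>T\<close> be an open set around \<open>E\<close> that is hardly longer than \<open>E\<close>. Choosing intervals of slow
growth in \<open>T\<close> and then intervals of fast growth inside those bounds the Stieltjes measure of the
first choice from both sides: \<open>q \<cdot> |E| \<le> p \<cdot> |T|\<close>. As \<open>p < q\<close>, the outer length of \<open>E\<close> is zero.\<close>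

lemma negligible_steep_and_shallow:
  assumes "0 \<le> p" "p < q" "E \<subseteq> {a<..<b}"
    and shallow: "\<And>x d. x \<in> E \<Longrightarrow> 0 < d \<Longrightarrow> \<exists>u v. u < v \<and> v - u < d \<and> x \<in> {u..v} \<and> F v - F u \<le> p * (v - u)"
    and steep: "\<And>x d. x \<in> E \<Longrightarrow> 0 < d \<Longrightarrow> \<exists>u v. u < v \<and> v - u < d \<and> x \<in> {u..v} \<and> q * (v - u) \<le> F v - F u"
  shows "negligible E"
proof (rule negligible_outer_length_0, rule ccontr)
  assume pos: "outer_length E \<noteq> 0"
  have "outer_length E \<le> emeasure lborel {a<..<b}"
    unfolding outer_length_def using assms(3) by (intro INF_lower) auto
  also have "\<dots> < \<infinity>" by (cases "a \<le> b") auto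
  finally obtain m where m: "outer_length E = ennreal m" "0 \<le> m" "0 < m"
    using pos by (cases "outer_length E") (auto simp: order_less_le)
  define Y where "Y = m + (q - p) * m / (p + 1)"
  \<comment> \<open>\<open>Y\<close> is above the outer length \<open>m\<close>, yet \<open>p * Y < q * m\<close>.\<close>
  have "m < Y" using m assms(1,2) unfolding Y_def by (auto intro!: divide_pos_pos)
  then have "outer_length E < ennreal Y"
    using m by (simp add: ennreal_lessI)
  then obtain T where T: "open T" "E \<subseteq> T" "emeasure lborel T < ennreal Y"
    unfolding outer_length_def by (auto simp: INF_less_iff)
  obtain V where V: "open V" "V \<subseteq> T" "negligible (E - V)"
    "emeasure (interval_measure F) V \<le> ennreal p * emeasure lborel T"
    using shallow_cover[OF T(1,2) assms(1) shallow] by metis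
  have "outer_length E \<le> outer_length (E \<inter> V)"
    unfolding outer_length_def[of "E \<inter> V"]
  proof (rule INF_greatest)
    fix S assume "S \<in> {T. open T \<and> E \<inter> V \<subseteq> T}"
    then show "outer_length E \<le> emeasure lborel S"
      by (intro outer_length_le_up_to_negligible negligible_subset[OF V(3)]) auto
  qed
  then have "ennreal q * ennreal m \<le> ennreal q * outer_length (E \<inter> V)"
    using m by (intro mult_left_mono) auto
  also have "\<dots> \<le> emeasure (interval_measure F) V"
    using assms(1,2) by (intro outer_length_steep V(1) steep) auto
  also have "\<dots> \<le> ennreal p * emeasure lborel T" by (fact V)
  also have "\<dots> \<le> ennreal p * ennreal Y"
    using T by (intro mult_left_mono) auto
  finally have "q * m \<le> p * Y"
    using m assms(1,2) \<open>m < Y\<close> by (simp add: ennreal_mult[symmetric])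
  then have "(q - p) * m \<le> (q - p) * m * (p / (p + 1))" by (simp add: Y_def algebra_simps diff_divide_distrib)
  moreover have "(q - p) * m * (p / (p + 1)) < (q - p) * m * 1"
    using m assms(1,2) by (intro mult_strict_left_mono) auto
  ultimately show False by simp
qed

text \<open>The increment of \<open>F\<close> over \<open>{a<..<b}\<close> is finite but would exceed every multiple of the outer length.\<close>

lemma negligible_infinitely_steep:
  assumes "E \<subseteq> {a<..<b}"
    and steep: "\<And>x d q. x \<in> E \<Longrightarrow> 0 < d \<Longrightarrow> \<exists>u v. u < v \<and> v - u < d \<and> x \<in> {u..v} \<and> q * (v - u) \<le> F v - F u"
  shows "negligible E"
proof (cases "E = {}")
  case False
  then have "a < b" using assms(1) by force
  have le: "ennreal q * outer_length E \<le> ennreal (F b - F a)" if "0 \<le> q" for q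
  proof -
    have "ennreal q * outer_length E \<le> emeasure (interval_measure F) {a<..<b}"
      by (rule outer_length_steep[OF _ assms(1) that steep]) auto
    then show ?thesis using emeasure_interval_measure_Ioo[OF _ mono cont, of a b] \<open>a < b\<close> by simp
  qed
  show ?thesis
  proof (rule negligible_outer_length_0, rule ccontr)
    assume "outer_length E \<noteq> 0"
    moreover have "outer_length E < \<infinity>" using le[of 1] by (simp add: le_less_trans)
    ultimately obtain m where m: "outer_length E = ennreal m" "0 < m"
      by (cases "outer_length E") (auto simp: order_less_le)
    define q where "q = (F b - F a + 1) / m"
    have "0 \<le> q" "q * m = F b - F a + 1" using m mono[of a b] \<open>a < b\<close> by (auto simp: q_def)
    then show False using le[of q] m mono[of a b] \<open>a < b\<close> by (auto simp: ennreal_mult[symmetric])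
  qed
qed auto

text \<open>Lebesgue's theorem on monotone functions, for continuous ones. If \<open>F\<close> has no derivative at a point,
then either its upper derivative there is infinite, or two rational numbers separate the lower
derivative from the upper one. The former points form one negligible set, the latter a countable
union of negligible sets.\<close>

theorem negligible_not_differentiable_mono:
  "negligible {x. \<not> F field_differentiable at x}"
proof -
  define r where "r x h = (F (x + h) - F x) / h" for x h
  define shallow where "shallow p x \<longleftrightarrow> (\<forall>d>0. \<exists>u v. u < v \<and> v - u < d \<and> x \<in> {u..v} \<and> F v - F u \<le> p * (v - u))" for p x
  define steep where "steep q x \<longleftrightarrow> (\<forall>d>0. \<exists>u v. u < v \<and> v - u < d \<and> x \<in> {u..v} \<and> q * (v - u) \<le> F v - F u)" for q x
  have r_nonneg: "0 \<le> r x h" for x h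
    
    using mono[of x "x + h"] mono[of "x + h" x] by (cases "0 \<le> h") (simp_all add: r_def divide_nonpos_nonpos)
  have shallowI: "shallow p x" if "\<exists>\<^sub>F h in at 0. r x h < p" for p x
    unfolding shallow_def
  proof (intro allI impI)
    fix d :: real assume "0 < d"
    then have "\<exists>\<^sub>F h in at 0. r x h < p \<and> \<bar>h\<bar> < d \<and> h \<noteq> 0"
      using that by (intro frequently_eventually_frequently) (auto simp: eventually_at intro!: exI[of _ d])
    then obtain h where h: "r x h < p" "\<bar>h\<bar> < d" "h \<noteq> 0" by (auto dest: frequently_ex)
    show "\<exists>u v. u < v \<and> v - u < d \<and> x \<in> {u..v} \<and> F v - F u \<le> p * (v - u)"
    proof (cases "h > 0")
      case True
      then show ?thesis using h
        by (intro exI[of _ x] exI[of _ "x + h"]) (auto simp: r_def field_simps)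
    next
      case False
      then show ?thesis using h
        by (intro exI[of _ "x + h"] exI[of _ x]) (auto simp: r_def field_simps)
    qed
  qed
  have steepI: "steep q x" if "\<exists>\<^sub>F h in at 0. q < r x h" for q x
    unfolding steep_def
  proof (intro allI impI)
    fix d :: real assume "0 < d"
    then have "\<exists>\<^sub>F h in at 0. q < r x h \<and> \<bar>h\<bar> < d \<and> h \<noteq> 0"
      using that by (intro frequently_eventually_frequently) (auto simp: eventually_at intro!: exI[of _ d])
    then obtain h where h: "q < r x h" "\<bar>h\<bar> < d" "h \<noteq> 0" by (auto dest: frequently_ex)
    show "\<exists>u v. u < v \<and> v - u < d \<and> x \<in> {u..v} \<and> q * (v - u) \<le> F v - F u"
    proof (cases "h > 0")
      case True
      then show ?thesis using h
        by (intro exI[of _ x] exI[of _ "x + h"]) (auto simp: r_def field_simps)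
    next
      case False
      then show ?thesis using h
        by (intro exI[of _ "x + h"] exI[of _ x]) (auto simp: r_def field_simps)
    qed
  qed
  have alternatives: "(\<forall>q. steep q x) \<or> (\<exists>p\<in>\<rat>. \<exists>q\<in>\<rat>. 0 \<le> p \<and> p < q \<and> shallow p x \<and> steep q x)"
    if ndiff: "\<not> F field_differentiable at x" for x
  proof -
    define lo hi where "lo = Liminf (at 0) (\<lambda>h. ereal (r x h))" and "hi = Limsup (at 0) (\<lambda>h. ereal (r x h))"
    have "lo \<le> hi" unfolding lo_def hi_def by (intro Liminf_le_Limsup) auto
    have "0 \<le> lo" unfolding lo_def using r_nonneg by (intro Liminf_bounded) auto
    have st: "steep q x" if "ereal q < hi" for q
    proof (rule steepI)
      show "\<exists>\<^sub>F h in at 0. q < r x h"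
      proof (rule ccontr)
        assume "\<not> (\<exists>\<^sub>F h in at 0. q < r x h)"
        then have "\<forall>\<^sub>F h in at 0. ereal (r x h) \<le> ereal q" by (simp add: frequently_def not_less)
        then have "hi \<le> ereal q" unfolding hi_def by (rule Limsup_bounded)
        then show False using that by simp
      qed
    qed
    have sh: "shallow p x" if "lo < ereal p" for p
    proof (rule shallowI)
      show "\<exists>\<^sub>F h in at 0. r x h < p"
      proof (rule ccontr)
        assume "\<not> (\<exists>\<^sub>F h in at 0. r x h < p)"
        then have "\<forall>\<^sub>F h in at 0. ereal p \<le> ereal (r x h)" by (simp add: frequently_def not_less)
        then have "ereal p \<le> lo" unfolding lo_def by (rule Liminf_bounded)
        then show False using that by simp
      qed
    qed
    show ?thesis
    proof (cases "hi = \<infinity>")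
      case True
      then show ?thesis using st by auto
    next
      case False
      have "lo \<noteq> hi"
      proof
        assume "lo = hi"
        then obtain l where l: "lo = ereal l" "hi = ereal l"
          using False \<open>0 \<le> lo\<close> by (cases lo) auto
        then have "((\<lambda>h. ereal (r x h)) \<longlongrightarrow> ereal l) (at 0)"
          unfolding lo_def hi_def by (intro Liminf_eq_Limsup) auto
        then have "(r x \<longlongrightarrow> l) (at 0)" by simp
        then have "(F has_field_derivative l) (at x)"
          by (simp add: DERIV_def r_def[abs_def])
        then show False using ndiff field_differentiable_def by blast
      qed
      then have "lo < hi" using \<open>lo \<le> hi\<close> by simp
      obtain q where q: "lo < ereal (of_rat q)" "ereal (of_rat q) < hi"
        using ereal_dense3[OF \<open>lo < hi\<close>] by auto
      obtain p where p: "lo < ereal (of_rat p)" "ereal (of_rat p) < ereal (of_rat q)"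
        using ereal_dense3[OF q(1)] by auto
      have "(0::real) \<le> of_rat p" using \<open>0 \<le> lo\<close> p(1) by (metis ereal_less_eq(5) less_imp_le order_trans)
      then show ?thesis using sh[OF p(1)] st[OF q(2)] p(2)
        by (intro disjI2 bexI[of _ "of_rat p"] bexI[of _ "of_rat q"]) auto
    qed
  qed
  define E1 where "E1 n = {x\<in>{-real n<..<real n}. \<forall>q. steep q x}" for n
  define E2 where "E2 n p q = {x\<in>{-real n<..<real n}. shallow p x \<and> steep q x}" for n p q
  have "negligible (E1 n)" for n
    by (rule negligible_infinitely_steep[of _ "- real n" "real n"]) (auto simp: E1_def steep_def)
  moreover have "negligible (E2 n p q)" if "0 \<le> p" "p < q" for n p q
    by (rule negligible_steep_and_shallow[OF that, of _ "- real n" "real n"])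
      (auto simp: E2_def steep_def shallow_def)
  moreover have "countable {(p::real, q::real). p \<in> \<rat> \<and> q \<in> \<rat> \<and> 0 \<le> p \<and> p < q}"
    by (rule countable_subset[OF _ countable_SIGMA[OF countable_rat countable_rat]]) auto
  ultimately have "negligible ((\<Union>n. E1 n) \<union> (\<Union>n. \<Union>(p, q)\<in>{(p, q). p \<in> \<rat> \<and> q \<in> \<rat> \<and> 0 \<le> p \<and> p < q}. E2 n p q))"
    by (intro negligible_Un negligible_countable_Union countable_image countableI_type) auto
  then show ?thesis
  proof (rule negligible_subset, intro subsetI)
    fix x assume x: "x \<in> {x. \<not> F field_differentiable at x}"
    obtain n where "\<bar>x\<bar> < real n" using reals_Archimedean2 by blast
    then have "x \<in> {-real n<..<real n}" by auto
    then show "x \<in> (\<Union>n. E1 n) \<union> (\<Union>n. \<Union>(p, q)\<in>{(p, q). p \<in> \<rat> \<and> q \<in> \<rat> \<and> 0 \<le> p \<and> p < q}. E2 n p q)"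
      using alternatives[of x] x unfolding E1_def E2_def by blast
  qed
qed

end

section \<open>Increments of absolutely continuous functions\<close>

lemma abs_cont_on_interval_dominated:
  assumes f: "abs_cont_on_interval a b f" and "0 \<le> C"
    and le: "\<And>u v. a \<le> u \<Longrightarrow> u \<le> v \<Longrightarrow> v \<le> b \<Longrightarrow> \<bar>g v - g u\<bar> \<le> (v - u) + C * \<bar>f v - f u\<bar>"
  shows "abs_cont_on_interval a b g"
  unfolding abs_cont_on_interval_def
proof (intro allI impI)
  fix \<epsilon> :: real assume "0 < \<epsilon>"
  \<comment> \<open>One half of \<open>\<epsilon>\<close> is spent on the lengths \<open>v - u\<close>, the other half on the increments of \<open>f\<close>.\<close>
  define e where "e = \<epsilon> / (2 * (C + 1))"
  have "0 < e" using \<open>0 < \<epsilon>\<close> \<open>0 \<le> C\<close> by (simp add: e_def)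
  then obtain \<delta> where \<delta>: "0 < \<delta>" "\<And>P. finite P \<and> (\<forall>(u, v)\<in>P. a \<le> u \<and> u < v \<and> v \<le> b) \<and>
        disjoint_family_on (\<lambda>(u, v). {u<..<v}) P \<and> (\<Sum>(u, v)\<in>P. v - u) < \<delta>
        \<Longrightarrow> (\<Sum>(u, v)\<in>P. \<bar>f v - f u\<bar>) < e"
    using f unfolding abs_cont_on_interval_def by meson
  show "\<exists>\<delta>>0. \<forall>P. finite P \<and> (\<forall>(u, v)\<in>P. a \<le> u \<and> u < v \<and> v \<le> b) \<and>
        disjoint_family_on (\<lambda>(u, v). {u<..<v}) P \<and> (\<Sum>(u, v)\<in>P. v - u) < \<delta>
        \<longrightarrow> (\<Sum>(u, v)\<in>P. \<bar>g v - g u\<bar>) < \<epsilon>"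
  proof (intro exI[of _ "min \<delta> (\<epsilon> / 2)"] conjI allI impI)
    fix P :: "(real \<times> real) set"
    assume P: "finite P \<and> (\<forall>(u, v)\<in>P. a \<le> u \<and> u < v \<and> v \<le> b) \<and>
        disjoint_family_on (\<lambda>(u, v). {u<..<v}) P \<and> (\<Sum>(u, v)\<in>P. v - u) < min \<delta> (\<epsilon> / 2)"
    have "(\<Sum>(u, v)\<in>P. \<bar>g v - g u\<bar>) \<le> (\<Sum>(u, v)\<in>P. (v - u) + C * \<bar>f v - f u\<bar>)"
    proof (rule sum_mono)
      fix i assume "i \<in> P"
      then show "(case i of (u, v) \<Rightarrow> \<bar>g v - g u\<bar>) \<le> (case i of (u, v) \<Rightarrow> (v - u) + C * \<bar>f v - f u\<bar>)"
        using P le[of "fst i" "snd i"] by (cases i) force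
    qed
    also have "\<dots> = (\<Sum>(u, v)\<in>P. v - u) + C * (\<Sum>(u, v)\<in>P. \<bar>f v - f u\<bar>)"
      by (simp add: sum.distrib sum_distrib_left case_prod_beta)
    also have "\<dots> < \<epsilon> / 2 + C * e + e"
    proof -
      have "(\<Sum>(u, v)\<in>P. \<bar>f v - f u\<bar>) < e" using \<delta>(2)[of P] P by simp
      then have "C * (\<Sum>(u, v)\<in>P. \<bar>f v - f u\<bar>) \<le> C * e" using \<open>0 \<le> C\<close> by (intro mult_left_mono) auto
      then show ?thesis using P \<open>0 < e\<close> by linarith
    qed
    also have "\<epsilon> / 2 + C * e + e = \<epsilon> / 2 + (C + 1) * e" by (simp add: algebra_simps)
    also have "(C + 1) * e = \<epsilon> / 2" using \<open>0 \<le> C\<close> by (simp add: e_def field_simps)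
    also have "\<epsilon> / 2 + \<epsilon> / 2 = \<epsilon>" by simp
    finally show "(\<Sum>(u, v)\<in>P. \<bar>g v - g u\<bar>) < \<epsilon>" .
  qed (use \<delta> \<open>0 < \<epsilon>\<close> in auto)
qed

text \<open>The tag \<open>x\<close> has to lie between \<open>u\<close> and \<open>v\<close>: the errors on its two sides then add up to \<open>e * (v - u)\<close>.\<close>

lemma straddle_estimate:
  fixes g :: "real \<Rightarrow> real"
  assumes "(g has_real_derivative D) (at x within S)" "0 < e"
  obtains d where "0 < d"
    "\<And>u v. u \<in> S \<Longrightarrow> v \<in> S \<Longrightarrow> u \<le> x \<Longrightarrow> x \<le> v \<Longrightarrow> {u..v} \<subseteq> ball x d \<Longrightarrow> g v - g u \<le> (D + e) * (v - u)"
proof -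
  from assms obtain d where d: "0 < d"
    "\<And>y. y \<in> S \<Longrightarrow> \<bar>y - x\<bar> < d \<Longrightarrow> \<bar>g y - g x - D * (y - x)\<bar> \<le> e * \<bar>y - x\<bar>"
    unfolding has_field_derivative_def has_derivative_within_alt
    by (auto simp: mult.commute)
  show ?thesis
  proof (rule that[OF d(1)])
    fix u v assume *: "u \<in> S" "v \<in> S" "u \<le> x" "x \<le> v" "{u..v} \<subseteq> ball x d"
    then have "u \<in> ball x d" "v \<in> ball x d" by (meson atLeastAtMost_iff order_refl order_trans subsetD)+
    then have "\<bar>g v - g x - D * (v - x)\<bar> \<le> e * (v - x)" "\<bar>g u - g x - D * (u - x)\<bar> \<le> e * (x - u)"
      using d(2)[of u] d(2)[of v] * by (auto simp: dist_real_def)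
    then show "g v - g u \<le> (D + e) * (v - u)" unfolding abs_le_iff by (simp add: algebra_simps)
  qed
qed

text \<open>A mean value inequality that tolerates a null set of exceptional points. Choose a gauge for which an
interval with a good tag satisfies the straddle estimate, while an interval whose tag is in \<open>Z\<close> lies
in a fixed open set of length less than \<open>\<delta>\<close>. In a fine tagged division the good intervals contribute
at most \<open>(\<rho> + e) * (b - a)\<close>, and the bad ones less than \<open>e\<close> by absolute continuity.\<close>

theorem abs_cont_increment_le:
  fixes g :: "real \<Rightarrow> real"
  assumes "a \<le> b" "0 \<le> \<rho>" and ac: "abs_cont_on_interval a b g" and Z: "negligible Z"
    and deriv: "\<And>x. x \<in> {a..b} \<Longrightarrow> x \<notin> Z \<Longrightarrow> \<exists>D\<le>\<rho>. (g has_real_derivative D) (at x within {a..b})"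
  shows "g b - g a \<le> \<rho> * (b - a)"
proof (rule field_le_epsilon)
  fix e' :: real assume "0 < e'"
  define e where "e = e' / (b - a + 1)"
  have "0 < e" using \<open>0 < e'\<close> \<open>a \<le> b\<close> by (simp add: e_def)
  obtain \<delta> where \<delta>: "0 < \<delta>" "\<And>P. finite P \<and> (\<forall>(u, v)\<in>P. a \<le> u \<and> u < v \<and> v \<le> b) \<and>
        disjoint_family_on (\<lambda>(u, v). {u<..<v}) P \<and> (\<Sum>(u, v)\<in>P. v - u) < \<delta>
        \<Longrightarrow> (\<Sum>(u, v)\<in>P. \<bar>g v - g u\<bar>) < e"
    using ac \<open>0 < e\<close> unfolding abs_cont_on_interval_def by meson
  obtain T where T: "open T" "Z \<subseteq> T" "emeasure lborel T < ennreal \<delta>"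
  proof -
    have null: "Z \<in> null_sets lebesgue" using Z negligible_iff_null_sets by blast
    then have "Z \<in> sets lebesgue" by auto
    from sets_lebesgue_outer_open[OF this \<open>0 < \<delta>\<close>] obtain T where T: "open T" "Z \<subseteq> T"
      "emeasure lebesgue (T - Z) < ennreal \<delta>" by metis
    have "emeasure lebesgue T = emeasure lebesgue (T - Z)"
      using null T by (intro emeasure_Diff_null_set[symmetric]) auto
    then show ?thesis using that T by simp
  qed
  have "\<exists>d>0. (x \<in> Z \<longrightarrow> ball x d \<subseteq> T) \<and> (x \<in> {a..b} - Z \<longrightarrow>
      (\<forall>u v. a \<le> u \<longrightarrow> u \<le> x \<longrightarrow> x \<le> v \<longrightarrow> v \<le> b \<longrightarrow> {u..v} \<subseteq> ball x d \<longrightarrow> g v - g u \<le> (\<rho> + e) * (v - u)))" for x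
  proof (cases "x \<in> Z")
    case True
    then show ?thesis using T by (metis DiffD2 openE subsetD)
  next
    case nZ: False
    show ?thesis
    proof (cases "x \<in> {a..b}")
      case True
      obtain D where D: "D \<le> \<rho>" "(g has_real_derivative D) (at x within {a..b})"
        using deriv[OF True nZ] by auto
      obtain d where d: "0 < d" "\<And>u v. u \<in> {a..b} \<Longrightarrow> v \<in> {a..b} \<Longrightarrow> u \<le> x \<Longrightarrow> x \<le> v \<Longrightarrow> {u..v} \<subseteq> ball x d
          \<Longrightarrow> g v - g u \<le> (D + e) * (v - u)"
        using straddle_estimate[OF D(2) \<open>0 < e\<close>] by blast
      have "g v - g u \<le> (\<rho> + e) * (v - u)" if "a \<le> u" "u \<le> x" "x \<le> v" "v \<le> b" "{u..v} \<subseteq> ball x d" for u v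
      proof -
        have "(D + e) * (v - u) \<le> (\<rho> + e) * (v - u)" using D that by (intro mult_right_mono) auto
        then show ?thesis using d(2)[of u v] that by auto
      qed
      then show ?thesis using d(1) nZ by blast
    qed (use nZ in \<open>auto intro: exI[of _ 1]\<close>)
  qed
  then obtain d where d: "\<And>x. 0 < d x" "\<And>x. x \<in> Z \<Longrightarrow> ball x (d x) \<subseteq> T"
    "\<And>x u v. x \<in> {a..b} - Z \<Longrightarrow> a \<le> u \<Longrightarrow> u \<le> x \<Longrightarrow> x \<le> v \<Longrightarrow> v \<le> b \<Longrightarrow> {u..v} \<subseteq> ball x (d x)
       \<Longrightarrow> g v - g u \<le> (\<rho> + e) * (v - u)"
    by metis
  have "gauge (\<lambda>x. ball x (d x))" using d(1) by (simp add: gauge_ball_dependent)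
  then obtain p where p: "p tagged_division_of {a..b}" "(\<lambda>x. ball x (d x)) fine p"
    using fine_division_exists_real by metis
  have fin: "finite p" using p(1) by blast
  have K: "Inf K \<le> x \<and> x \<le> Sup K \<and> a \<le> Inf K \<and> Sup K \<le> b \<and> K = {Inf K..Sup K} \<and> K \<subseteq> ball x (d x)"
    if xK: "(x, K) \<in> p" for x K
  proof -
    obtain u v where uv: "K = cbox u v" using tagged_division_ofD(4)[OF p(1) xK] by blast
    have "x \<in> K" "K \<subseteq> {a..b}" using tagged_division_ofD(2,3)[OF p(1) xK] by auto
    moreover have "K \<subseteq> ball x (d x)" using p(2) xK by (auto simp: fine_def)
    ultimately show ?thesis using uv by auto
  qed
  define bad where "bad = {(x, K) \<in> p. x \<in> Z \<and> Inf K < Sup K}"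
  \<comment> \<open>Degenerate intervals are left out of \<open>bad\<close> so that distinct members have distinct end points.\<close>
  define ends where "ends = (\<lambda>(x :: real, K :: real set). (Inf K, Sup K))"
  have disj: "{Inf K<..<Sup K} \<inter> {Inf L<..<Sup L} = {}" if "(x, K) \<in> p" "(y, L) \<in> p" "(x, K) \<noteq> (y, L)" for x y K L
  proof -
    have "interior K = {Inf K<..<Sup K}" "interior L = {Inf L<..<Sup L}"
      using K[OF that(1)] K[OF that(2)] interior_atLeastAtMost_real by metis+
    then show ?thesis using tagged_division_ofD(5)[OF p(1) that] by simp
  qed
  have inj: "inj_on ends bad"
  proof (rule inj_onI)
    fix i j assume ij: "i \<in> bad" "j \<in> bad" "ends i = ends j"
    obtain x K y L where [simp]: "i = (x, K)" "j = (y, L)" by (cases i; cases j)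
    have "{Inf K<..<Sup K} \<noteq> {}" "Inf K = Inf L" "Sup K = Sup L" using ij by (auto simp: bad_def ends_def)
    then show "i = j" using disj[of x K y L] ij by (auto simp: bad_def)
  qed
  define P where "P = ends ` bad"
  have "finite bad" using fin by (rule finite_subset[rotated]) (auto simp: bad_def)
  then have finP: "finite P" by (simp add: P_def)
  have Pdisj: "disjoint_family_on (\<lambda>(u, v). {u<..<v}) P"
    unfolding disjoint_family_on_def
  proof (intro ballI impI)
    fix m n assume mn: "m \<in> P" "n \<in> P" "m \<noteq> n"
    then obtain x K y L where "(x, K) \<in> bad" "m = ends (x, K)" "(y, L) \<in> bad" "n = ends (y, L)"
      by (auto simp: P_def)
    then show "(case m of (u, v) \<Rightarrow> {u<..<v}) \<inter> (case n of (u, v) \<Rightarrow> {u<..<v}) = {}"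
      using disj[of x K y L] mn(3) by (auto simp: ends_def bad_def)
  qed
  have PT: "u < v \<and> a \<le> u \<and> v \<le> b \<and> {u<..<v} \<subseteq> T" if uv: "(u, v) \<in> P" for u v
  proof -
    obtain x K where xK: "(x, K) \<in> p" "x \<in> Z" "Inf K < Sup K" "u = Inf K" "v = Sup K"
      using uv by (auto simp: P_def bad_def ends_def)
    then have "{u<..<v} \<subseteq> K" using K[OF xK(1)] by (metis greaterThanLessThan_subseteq_atLeastAtMost_iff order_refl)
    then show ?thesis using K[OF xK(1)] d(2)[OF xK(2)] xK by blast
  qed
  have "ennreal (\<Sum>(u, v)\<in>P. v - u) = (\<Sum>(u, v)\<in>P. emeasure lborel {u<..<v})"
  proof -
    have "ennreal (\<Sum>(u, v)\<in>P. v - u) = (\<Sum>i\<in>P. ennreal (case i of (u, v) \<Rightarrow> v - u))"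
      using PT by (intro sum_ennreal[symmetric]) force
    also have "\<dots> = (\<Sum>(u, v)\<in>P. emeasure lborel {u<..<v})"
      using PT by (intro sum.cong) (force simp: less_imp_le)+
    finally show ?thesis .
  qed
  also have "\<dots> = (\<Sum>i\<in>P. emeasure lborel (case i of (u, v) \<Rightarrow> {u<..<v}))"
    by (simp add: case_prod_beta)
  also have "\<dots> = emeasure lborel (\<Union>(u, v)\<in>P. {u<..<v})"
    using Pdisj finP by (intro sum_emeasure) auto
  also have "\<dots> \<le> emeasure lborel T" using PT T by (intro emeasure_mono) auto
  also have "\<dots> < ennreal \<delta>" by (fact T(3))
  finally have "(\<Sum>(u, v)\<in>P. v - u) < \<delta>"
    using \<open>0 < \<delta>\<close> ennreal_less_iff[of "\<Sum>(u, v)\<in>P. v - u" \<delta>] PT by (force intro!: sum_nonneg)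
  then have "(\<Sum>(u, v)\<in>P. \<bar>g v - g u\<bar>) < e" using \<delta>(2)[of P] finP Pdisj PT by blast
  then have bad_sum: "(\<Sum>(x, K)\<in>bad. \<bar>g (Sup K) - g (Inf K)\<bar>) < e"
    unfolding P_def sum.reindex[OF inj] by (simp add: ends_def case_prod_beta)
  have "g b - g a = (\<Sum>(x, K)\<in>p. g (Sup K) - g (Inf K))"
    using additive_tagged_division_1[OF \<open>a \<le> b\<close> p(1), of g] by simp
  also have "\<dots> \<le> (\<Sum>(x, K)\<in>p. (\<rho> + e) * (Sup K - Inf K) + (if (x, K) \<in> bad then \<bar>g (Sup K) - g (Inf K)\<bar> else 0))"
  proof (rule sum_mono, clarify)
    fix x K assume xK: "(x, K) \<in> p"
    note KK = K[OF xK]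
    have nn: "0 \<le> (\<rho> + e) * (Sup K - Inf K)" using KK \<open>0 < e\<close> \<open>0 \<le> \<rho>\<close> by simp
    show "g (Sup K) - g (Inf K) \<le> (\<rho> + e) * (Sup K - Inf K) + (if (x, K) \<in> bad then \<bar>g (Sup K) - g (Inf K)\<bar> else 0)"
    proof (cases "x \<in> Z")
      case True
      show ?thesis
      proof (cases "Inf K < Sup K")
        case True
        then show ?thesis using nn xK \<open>x \<in> Z\<close> by (simp add: bad_def)
      next
        case False
        then have "Sup K = Inf K" using KK by linarith
        then show ?thesis by simp
      qed
    next
      case False
      then have "g (Sup K) - g (Inf K) \<le> (\<rho> + e) * (Sup K - Inf K)"
        using KK by (intro d(3)[of x]) auto
      then show ?thesis by auto
    qed
  qed
  also have "\<dots> = (\<rho> + e) * (\<Sum>(x, K)\<in>p. Sup K - Inf K)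
      + (\<Sum>i\<in>p. if i \<in> bad then \<bar>g (Sup (snd i)) - g (Inf (snd i))\<bar> else 0)"
    by (simp add: case_prod_beta sum.distrib sum_distrib_left)
  also have "(\<Sum>i\<in>p. if i \<in> bad then \<bar>g (Sup (snd i)) - g (Inf (snd i))\<bar> else 0)
      = (\<Sum>i\<in>bad. \<bar>g (Sup (snd i)) - g (Inf (snd i))\<bar>)"
    using fin by (intro sum.mono_neutral_cong_right) (auto simp: bad_def)
  also have "(\<Sum>(x, K)\<in>p. Sup K - Inf K) = b - a"
    using additive_tagged_division_1[OF \<open>a \<le> b\<close> p(1), of "\<lambda>x. x"] by simp
  also have "(\<Sum>i\<in>bad. \<bar>g (Sup (snd i)) - g (Inf (snd i))\<bar>) = (\<Sum>(x, K)\<in>bad. \<bar>g (Sup K) - g (Inf K)\<bar>)"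
    by (simp add: case_prod_beta)
  finally have "g b - g a \<le> (\<rho> + e) * (b - a) + e" using bad_sum by linarith
  also have "\<dots> = \<rho> * (b - a) + e * (b - a + 1)" by (simp add: algebra_simps)
  also have "e * (b - a + 1) = e'" using \<open>a \<le> b\<close> by (simp add: e_def)
  finally show "g b - g a \<le> \<rho> * (b - a) + e'" .
qed

section \<open>The averaged identity and its derivative\<close>

locale utility =
  fixes \<theta> :: real and s :: "real \<Rightarrow> real"
  assumes \<theta>_pos: "0 < \<theta>" and util: "dickman_utility s"
begin

abbreviation sinv :: "real \<Rightarrow> real" where "sinv \<equiv> inv_into {0..} s"

lemma s_less_iff: "0 \<le> x \<Longrightarrow> 0 \<le> y \<Longrightarrow> s x < s y \<longleftrightarrow> x < y"
  using util strict_mono_on_less[of "{0..}" s x y] by (simp add: dickman_utility_def)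

lemma s_le_iff: "0 \<le> x \<Longrightarrow> 0 \<le> y \<Longrightarrow> s x \<le> s y \<longleftrightarrow> x \<le> y"
  using s_less_iff[of y x] by linarith

lemma s_0: "s 0 = 0" and s_1: "s 1 = 1"
  using util by (simp_all add: dickman_utility_def)

lemma s_nonneg: "0 \<le> x \<Longrightarrow> 0 \<le> s x"
  using s_le_iff[of 0 x] by (simp add: s_0)

lemma s_pos: "0 < x \<Longrightarrow> 0 < s x"
  using s_less_iff[of 0 x] by (simp add: s_0)

lemma s_ge_1: "1 \<le> x \<Longrightarrow> 1 \<le> s x"
  using s_le_iff[of 1 x] by (simp add: s_1)

lemma s_abs_cont: "0 \<le> a \<Longrightarrow> a \<le> b \<Longrightarrow> abs_cont_on_interval a b s"
  using util by (simp add: dickman_utility_def locally_abs_cont_def)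

lemma s_continuous_Icc: "continuous_on {0..b} s"
proof (cases "0 \<le> b")
  case True
  show ?thesis unfolding continuous_on_iff
  proof (intro ballI allI impI)
    fix x e :: real assume x: "x \<in> {0..b}" and "0 < e"
    obtain \<delta> where \<delta>: "0 < \<delta>" "\<And>P. finite P \<and> (\<forall>(u, v)\<in>P. 0 \<le> u \<and> u < v \<and> v \<le> b) \<and>
        disjoint_family_on (\<lambda>(u, v). {u<..<v}) P \<and> (\<Sum>(u, v)\<in>P. v - u) < \<delta>
        \<Longrightarrow> (\<Sum>(u, v)\<in>P. \<bar>s v - s u\<bar>) < e"
      using s_abs_cont[OF order_refl True] \<open>0 < e\<close> unfolding abs_cont_on_interval_def by meson
    have *: "\<bar>s v - s u\<bar> < e" if "0 \<le> u" "u < v" "v \<le> b" "v - u < \<delta>" for u v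
      using \<delta>(2)[of "{(u, v)}"] that by (simp add: disjoint_family_on_def)
    have "dist (s y) (s x) < e" if "y \<in> {0..b}" "dist y x < \<delta>" for y
      using *[of x y] *[of y x] that x \<open>0 < e\<close>
      by (cases x y rule: linorder_cases) (auto simp: dist_real_def abs_minus_commute)
    then show "\<exists>d>0. \<forall>y\<in>{0..b}. dist y x < d \<longrightarrow> dist (s y) (s x) < e" using \<delta>(1) by blast
  qed
qed auto

lemma s_continuous: "continuous_on {0..} s"
proof -
  have "continuous (at x within {0..}) s" if "0 \<le> x" for x
  proof -
    have "continuous (at x within {0..x + 1}) s"
      using s_continuous_Icc[of "x + 1"] that by (simp add: continuous_on_eq_continuous_within)
    moreover have "at x within {0..} = at x within {0..x + 1}"
      by (rule at_within_nhd[of x "{..<x + 1}"]) auto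
    ultimately show ?thesis by simp
  qed
  then show ?thesis by (simp add: continuous_on_eq_continuous_within)
qed

lemma sinv_s [simp]: "0 \<le> x \<Longrightarrow> sinv (s x) = x"
  by (rule inv_into_f_f) (auto intro!: inj_onI simp: order_eq_iff s_le_iff)

lemma in_range_s:
  assumes "0 \<le> y" "y \<le> s x" "0 \<le> x"
  obtains t where "0 \<le> t" "t \<le> x" "s t = y"
  using IVT'[of s 0 y x] assms s_continuous_Icc by (auto simp: s_0)

lemma sinv_bounds:
  assumes "0 \<le> y" "y \<le> s x" "0 \<le> x"
  shows "0 \<le> sinv y" "sinv y \<le> x" "s (sinv y) = y"
  using in_range_s[OF assms] by (metis sinv_s)+

lemma sinv_mono:
  assumes "0 \<le> y" "y \<le> z" "z \<le> s x" "0 \<le> x"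
  shows "sinv y \<le> sinv z"
  using sinv_bounds[of y x] sinv_bounds[of z x] s_le_iff[of "sinv y" "sinv z"] assms by auto

lemma sinv_less_iff:
  assumes "0 \<le> y" "y \<le> s x" "0 \<le> x" "0 \<le> v"
  shows "sinv y < v \<longleftrightarrow> y < s v"
  using sinv_bounds[OF assms(1-3)] s_less_iff[of "sinv y" v] assms(4) by auto

text \<open>Off the range of \<open>s\<close> the predicate under the choice operator is constantly false, whatever the
argument. Hence \<open>sinv\<close> is monotone on an interval and constant off it, which makes it Borel
measurable on the whole line.\<close>

lemma sinv_outside: "y \<notin> s ` {0..} \<Longrightarrow> sinv y = sinv (-1)"
proof -
  have *: "(SOME x. x \<in> {0..} \<and> s x = y) = (SOME x::real. False)" if "y \<notin> s ` {0..}" for y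
    by (rule arg_cong[of _ _ Eps]) (use that in auto)
  have "-1 \<notin> s ` {0..}" using s_nonneg by force
  then show "y \<notin> s ` {0..} \<Longrightarrow> sinv y = sinv (-1)"
    using *[of y] *[of "-1"] by (simp add: inv_into_def)
qed

lemma sinv_measurable [measurable]: "sinv \<in> borel_measurable borel"
proof -
  have conn: "connected (s ` {0..})"
    using s_continuous by (intro connected_continuous_image) (auto intro: convex_connected)
  then have sets: "s ` {0..} \<in> sets borel"
    by (intro real_interval_borel_measurable) (simp add: is_interval_connected_1)
  have "mono_on (s ` {0..}) sinv"
    by (rule mono_onI) (auto simp: s_le_iff)
  then have "sinv \<in> borel_measurable (restrict_space borel (s ` {0..}))"
    by (rule borel_measurable_mono_on_fnc)
  then have "(\<lambda>y. if y \<in> s ` {0..} then sinv y else sinv (-1)) \<in> borel_measurable borel"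
    using sets by (intro measurable_If_restrict_space_iff[THEN iffD2]) auto
  moreover have "(\<lambda>y. if y \<in> s ` {0..} then sinv y else sinv (-1)) = sinv"
    using sinv_outside by (intro ext) metis
  ultimately show ?thesis by simp
qed

lemma s_max_continuous: "continuous_on UNIV (\<lambda>x. s (max 0 x))"
  by (rule continuous_on_compose2[OF s_continuous]) (auto intro!: continuous_intros)

lemma s_max_measurable [measurable]: "(\<lambda>x. s (max 0 x)) \<in> borel_measurable borel"
  using s_max_continuous by (rule borel_measurable_continuous_onI)

lemma negligible_s_not_differentiable: "negligible {x. 0 < x \<and> \<not> s field_differentiable at x}"
proof (rule negligible_subset)
  show "negligible {x. \<not> (\<lambda>x. s (max 0 x)) field_differentiable at x}"
    by (rule negligible_not_differentiable_mono[OF _ s_max_continuous]) (simp add: s_le_iff)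
  show "{x. 0 < x \<and> \<not> s field_differentiable at x} \<subseteq> {x. \<not> (\<lambda>x. s (max 0 x)) field_differentiable at x}"
  proof safe
    fix x :: real assume "0 < x" "(\<lambda>x. s (max 0 x)) field_differentiable at x"
      and n: "\<not> s field_differentiable at x"
    then obtain D where "((\<lambda>x. s (max 0 x)) has_field_derivative D) (at x)"
      by (auto simp: field_differentiable_def)
    then have "(s has_field_derivative D) (at x)"
      by (rule has_field_derivative_transform_within_open[of _ _ _ "{0<..}"]) (use \<open>0 < x\<close> in auto)
    then show False using n field_differentiable_def by blast
  qed
qed

definition s_powr_integral :: "real \<Rightarrow> real" where "s_powr_integral x = integral {0..x} (\<lambda>v. s v powr \<theta>)"

text \<open>For \<open>x > 0\<close> this will turn out to be the mean of \<open>s\<^sup>-\<^sup>1(U\<^bsup>1/\<theta>\<^esup> s(x))\<close>, that is, the average of the identity on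
\<open>{0..x}\<close> with weights proportional to the increments of \<open>s\<^sup>\<theta>\<close>, after an integration by parts. In
this form its derivative can be read off.\<close>

definition averaged_id :: "real \<Rightarrow> real" where "averaged_id x = x - s_powr_integral x / s x powr \<theta>"

lemma s_powr_continuous: "continuous_on {0..b} (\<lambda>v. s v powr \<theta>)"
  using s_continuous_Icc \<theta>_pos s_nonneg by (intro continuous_on_powr') (auto intro: continuous_intros)

lemma s_powr_integrable: "{u..v} \<subseteq> {0..b} \<Longrightarrow> (\<lambda>v. s v powr \<theta>) integrable_on {u..v}"
  by (intro integrable_continuous_real continuous_on_subset[OF s_powr_continuous[of b]]) auto

lemma s_powr_integral_diff:
  assumes "0 \<le> u" "u \<le> v"
  shows "s_powr_integral v - s_powr_integral u = integral {u..v} (\<lambda>v. s v powr \<theta>)"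
  using Henstock_Kurzweil_Integration.integral_combine[of 0 u v "\<lambda>v. s v powr \<theta>"] assms s_powr_integrable[of 0 v v]
  by (simp add: s_powr_integral_def)

lemma s_powr_integral_diff_bounds:
  assumes "0 \<le> u" "u \<le> v"
  shows "0 \<le> s_powr_integral v - s_powr_integral u" "s_powr_integral v - s_powr_integral u \<le> (v - u) * s v powr \<theta>"
proof -
  have int: "(\<lambda>v. s v powr \<theta>) integrable_on {u..v}" using assms by (intro s_powr_integrable[of u v v]) auto
  show "0 \<le> s_powr_integral v - s_powr_integral u" unfolding s_powr_integral_diff[OF assms]
    using int by (intro integral_nonneg) auto
  have "integral {u..v} (\<lambda>v. s v powr \<theta>) \<le> integral {u..v} (\<lambda>_. s v powr \<theta>)"
    using int assms \<theta>_pos by (intro integral_le powr_mono2) (auto intro: s_nonneg simp: s_le_iff)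
  then show "s_powr_integral v - s_powr_integral u \<le> (v - u) * s v powr \<theta>" unfolding s_powr_integral_diff[OF assms] using assms by simp
qed

text \<open>The map \<open>y \<mapsto> y\<^bsup>-\<theta>\<^esup> + \<theta> y\<close> increases on \<open>{1..}\<close>.\<close>

lemma powr_neg_lipschitz:
  fixes y z :: real
  assumes "1 \<le> y" "y \<le> z"
  shows "y powr (-\<theta>) - z powr (-\<theta>) \<le> \<theta> * (z - y)"
proof -
  have "y powr (-\<theta>) + \<theta> * y \<le> z powr (-\<theta>) + \<theta> * z"
  proof (rule DERIV_nonneg_imp_nondecreasing[OF assms(2)])
    fix x assume "y \<le> x" "x \<le> z"
    then have "1 \<le> x" using assms by simp
    moreover have "x powr (-\<theta> - 1) \<le> x powr 0"
      using \<open>1 \<le> x\<close> \<theta>_pos by (intro powr_mono) auto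
    moreover have "((\<lambda>x. x powr (-\<theta>) + \<theta> * x) has_real_derivative (-\<theta>) * x powr (-\<theta> - 1) + \<theta>) (at x)"
      using \<open>1 \<le> x\<close> by (auto intro!: derivative_eq_intros)
    ultimately show "\<exists>D. ((\<lambda>x. x powr (-\<theta>) + \<theta> * x) has_real_derivative D) (at x) \<and> 0 \<le> D"
      using \<theta>_pos by (intro exI[of _ "(-\<theta>) * x powr (-\<theta> - 1) + \<theta>"]) auto
  qed
  then show ?thesis by (simp add: algebra_simps)
qed

text \<open>To the right of \<open>1\<close> the function \<open>s\<close> stays above \<open>1\<close>, so \<open>s\<^bsup>-\<theta>\<^esup>\<close> is Lipschitz in \<open>s\<close>, and
absolute continuity carries over from \<open>s\<close>.\<close>

lemma averaged_id_abs_cont: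
  assumes "1 \<le> a" "a \<le> b"
  shows "abs_cont_on_interval a b averaged_id"
proof (rule abs_cont_on_interval_dominated)
  show "abs_cont_on_interval a b s" using assms by (intro s_abs_cont) auto
  have G_nn: "0 \<le> s_powr_integral x" if "0 \<le> x" for x using s_powr_integral_diff_bounds(1)[of 0 x] that by (simp add: s_powr_integral_def)
  show "0 \<le> s_powr_integral b * \<theta>" using G_nn[of b] assms \<theta>_pos by simp
  fix u v assume uv: "a \<le> u" "u \<le> v" "v \<le> b"
  define P Q where "P = s u powr (-\<theta>)" and "Q = s v powr (-\<theta>)"
  have su: "1 \<le> s u" "s u \<le> s v" using uv assms s_ge_1 by (auto simp: s_le_iff)
  have PQ: "0 \<le> P - Q" "P - Q \<le> \<theta> * (s v - s u)" "0 \<le> Q" "Q * s v powr \<theta> = 1"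
    using powr_neg_lipschitz[OF su] su \<theta>_pos
    by (auto simp: P_def Q_def powr_minus intro!: le_imp_inverse_le powr_mono2)
  have "averaged_id v - averaged_id u = (v - u) - (s_powr_integral v - s_powr_integral u) * Q + s_powr_integral u * (P - Q)"
    by (simp add: averaged_id_def P_def Q_def powr_minus divide_inverse algebra_simps)
  moreover have "0 \<le> (s_powr_integral v - s_powr_integral u) * Q" using s_powr_integral_diff_bounds(1)[of u v] uv assms PQ by simp
  moreover have "(s_powr_integral v - s_powr_integral u) * Q \<le> v - u"
  proof -
    have "(s_powr_integral v - s_powr_integral u) * Q \<le> ((v - u) * s v powr \<theta>) * Q"
      using s_powr_integral_diff_bounds(2)[of u v] uv assms PQ by (intro mult_right_mono) auto
    also have "\<dots> = v - u" using PQ(4) by (simp add: mult.assoc mult.commute)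
    finally show ?thesis .
  qed
  moreover have "0 \<le> s_powr_integral u * (P - Q)" using G_nn[of u] uv assms PQ by simp
  moreover have "s_powr_integral u * (P - Q) \<le> s_powr_integral b * (\<theta> * (s v - s u))"
    using G_nn[of u] s_powr_integral_diff_bounds(1)[of u b] uv assms PQ by (intro mult_mono) auto
  ultimately show "\<bar>averaged_id v - averaged_id u\<bar> \<le> (v - u) + s_powr_integral b * \<theta> * \<bar>s v - s u\<bar>"
    using su uv by simp
qed

text \<open>The function \<open>I\<close> of the theorem is the derivative of the averaged identity: in the quotient rule
the two terms that do not contain \<open>s'\<close> cancel.\<close>

lemma averaged_id_derivative:
  assumes "0 < x" "x \<le> b" "0 \<le> a" "s field_differentiable at x"
  shows "(averaged_id has_real_derivative dickman_I \<theta> s x) (at x within {a..b})"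
proof -
  have s': "(s has_real_derivative deriv s x) (at x)"
    using assms(4) by (simp add: DERIV_deriv_iff_field_differentiable)
  have sx: "0 < s x" using assms(1) by (rule s_pos)
  have "((\<lambda>x. s x powr \<theta>) has_real_derivative \<theta> * s x powr (\<theta> - 1) * deriv s x) (at x)"
    using DERIV_fun_powr[OF s' sx, of \<theta>] by simp
  then have 1: "((\<lambda>x. s x powr \<theta>) has_real_derivative \<theta> * s x powr (\<theta> - 1) * deriv s x) (at x within {a..b})"
    by (rule has_field_derivative_at_within)
  have "(s_powr_integral has_real_derivative s x powr \<theta>) (at x within {0..b})"
    unfolding s_powr_integral_def[abs_def] using assms s_powr_continuous[of b]
    by (intro integral_has_real_derivative) auto
  then have 2: "(s_powr_integral has_real_derivative s x powr \<theta>) (at x within {a..b})"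
    by (rule has_field_derivative_subset) (use assms in auto)
  define P where "P = s x powr \<theta>"
  have P: "0 < P" "s x powr (\<theta> - 1) = P / s x" "s x powr (\<theta> + 1) = P * s x"
    using sx by (auto simp: P_def powr_diff powr_add)
  have "(averaged_id has_real_derivative 1 - (s x powr \<theta> * s x powr \<theta> - s_powr_integral x * (\<theta> * s x powr (\<theta> - 1) * deriv s x)) /
      (s x powr \<theta> * s x powr \<theta>)) (at x within {a..b})"
    unfolding averaged_id_def[abs_def]
    by (intro DERIV_diff DERIV_divide 1 2 DERIV_ident) (use sx in auto)
  also have "1 - (s x powr \<theta> * s x powr \<theta> - s_powr_integral x * (\<theta> * s x powr (\<theta> - 1) * deriv s x)) /
      (s x powr \<theta> * s x powr \<theta>) = dickman_I \<theta> s x"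
    unfolding dickman_I_def s_powr_integral_def[symmetric] P(2,3) P_def[symmetric] using P(1) sx
    by (simp add: field_simps)
  finally show ?thesis .
qed

text \<open>The essential bound on \<open>I\<close> controls the derivative outside a null set, which absolute continuity
makes harmless.\<close>

lemma averaged_id_increment_le:
  assumes "sup_norm_pos (dickman_I \<theta> s) \<le> ereal \<rho>" "0 \<le> \<rho>" "1 \<le> x" "x \<le> y"
  shows "averaged_id y - averaged_id x \<le> \<rho> * (y - x)"
proof -
  have "AE x in restrict_space lebesgue {0<..}. ereal \<bar>dickman_I \<theta> s x\<bar> \<le> sup_norm_pos (dickman_I \<theta> s)"
    unfolding sup_norm_pos_def by (rule esssup_AE)
  then have "AE x in restrict_space lebesgue {0<..}. \<bar>dickman_I \<theta> s x\<bar> \<le> \<rho>"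
    by eventually_elim (use assms(1) order_trans in fastforce)
  then have "AE x in lebesgue. x \<in> {0<..} \<longrightarrow> \<bar>dickman_I \<theta> s x\<bar> \<le> \<rho>"
    by (subst (asm) AE_restrict_space_iff) auto
  then obtain N where N: "N \<in> null_sets lebesgue" "{x. \<not> (x \<in> {0<..} \<longrightarrow> \<bar>dickman_I \<theta> s x\<bar> \<le> \<rho>)} \<subseteq> N"
    by (auto simp: eventually_ae_filter)
  show ?thesis
  proof (rule abs_cont_increment_le[OF assms(4,2)])
    show "abs_cont_on_interval x y averaged_id" using assms by (intro averaged_id_abs_cont) auto
    show "negligible (N \<union> {x. 0 < x \<and> \<not> s field_differentiable at x})"
      using N(1) by (intro negligible_Un negligible_s_not_differentiable) (simp add: negligible_iff_null_sets)
    fix z assume z: "z \<in> {x..y}" "z \<notin> N \<union> {x. 0 < x \<and> \<not> s field_differentiable at x}"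
    have "0 < z" using z(1) assms(3) by simp
    then have "\<bar>dickman_I \<theta> s z\<bar> \<le> \<rho>" using N(2) z(2) by blast
    then have "dickman_I \<theta> s z \<le> \<rho>" by simp
    moreover have "(averaged_id has_real_derivative dickman_I \<theta> s z) (at z within {x..y})"
      using z \<open>0 < z\<close> assms(3) by (intro averaged_id_derivative) auto
    ultimately show "\<exists>D\<le>\<rho>. (averaged_id has_real_derivative D) (at z within {x..y})" by blast
  qed
qed

end

section \<open>The transition map of the chain\<close>

lemma prob_space_unif01: "prob_space unif01"
  by (rule prob_space_uniform_measure) auto

interpretation unif01: prob_space unif01
  by (rule prob_space_unif01)

lemma AE_unif01: "AE u in unif01. 0 \<le> u \<and> u \<le> 1"
  by (intro AE_uniform_measureI) auto

lemma integrable_unif01_bounded: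
  fixes f :: "real \<Rightarrow> real"
  assumes "f \<in> borel_measurable borel" "\<And>u. \<bar>f u\<bar> \<le> C"
  shows "integrable unif01 f"
  using assms by (intro unif01.integrable_const_bound[where B = C]) auto

text \<open>Clipping the arguments makes every estimate on the transition map hold everywhere instead of almost
everywhere.\<close>

abbreviation clip :: "real \<Rightarrow> real" where "clip u \<equiv> max 0 (min 1 u)"

lemma clip_powr_bounds: "0 < \<theta> \<Longrightarrow> 0 \<le> clip u powr (1 / \<theta>) \<and> clip u powr (1 / \<theta>) \<le> 1"
  using powr_mono2[of "1 / \<theta>" "clip u" 1] by simp

lemma emeasure_unif01_clip_less:
  assumes "0 < \<theta>" "0 \<le> c" "c \<le> 1"
  shows "emeasure unif01 {u. clip u powr (1 / \<theta>) < c} = ennreal (c powr \<theta>)"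
proof -
  have iff: "u powr (1 / \<theta>) < c \<longleftrightarrow> u < c powr \<theta>" if "0 \<le> u" for u
  proof -
    have "u powr (1 / \<theta>) < c \<longleftrightarrow> (u powr (1 / \<theta>)) powr \<theta> < c powr \<theta>"
      using assms by (metis powr_ge_zero powr_less_mono2 powr_mono2 less_imp_le not_le)
    then show ?thesis using that assms by (simp add: powr_powr)
  qed
  have c1: "c powr \<theta> \<le> 1" using assms powr_mono2[of \<theta> c 1] by simp
  have "{0..1} \<inter> {u. clip u powr (1 / \<theta>) < c} = {0..<c powr \<theta>}"
    using iff c1 by (auto simp: max_def min_def)
  then show ?thesis by (simp add: emeasure_uniform_measure divide_ennreal_def)
qed

lemma integral_unif01_powr:
  assumes "0 < \<theta>"
  shows "(\<integral>u. clip u powr (1 / \<theta>) \<partial>unif01) = \<theta> / (\<theta> + 1)"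
proof -
  have "((\<lambda>u. u powr (1 / \<theta>)) has_integral (1 powr (1 / \<theta> + 1) / (1 / \<theta> + 1))) {0..1::real}"
    using assms by (intro has_integral_powr_from_0) (auto intro: less_le_trans[of _ 0])
  then have "((\<lambda>u. u powr (1 / \<theta>)) has_integral \<theta> / (\<theta> + 1)) {0..1::real}"
    using assms by (simp add: field_simps)
  then have "((\<lambda>u. if u \<in> {0..1::real} then u powr (1 / \<theta>) else 0) has_integral \<theta> / (\<theta> + 1)) UNIV"
    by (simp only: has_integral_restrict_UNIV)
  moreover have "(\<lambda>u. if u \<in> {0..1::real} then u powr (1 / \<theta>) else 0) = (\<lambda>u. u powr (1 / \<theta>) * indicator {0..1} u)"
    by (auto simp: indicator_def)
  ultimately have hi: "((\<lambda>u. u powr (1 / \<theta>) * indicator {0..1} u) has_integral \<theta> / (\<theta> + 1)) UNIV"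
    by metis
  have "(\<integral>\<^sup>+u. ennreal (clip u powr (1 / \<theta>)) \<partial>unif01)
      = (\<integral>\<^sup>+u. ennreal (clip u powr (1 / \<theta>)) * indicator {0..1} u \<partial>lborel)"
    by (subst nn_integral_uniform_measure) (auto simp: divide_ennreal_def)
  also have "\<dots> = (\<integral>\<^sup>+u. ennreal (u powr (1 / \<theta>) * indicator {0..1} u) \<partial>lborel)"
    by (intro nn_integral_cong) (auto simp: indicator_def)
  also have "\<dots> = ennreal (\<theta> / (\<theta> + 1))"
    using hi by (intro nn_integral_has_integral_lborel) auto
  finally show ?thesis using assms by (subst integral_eq_nn_integral) auto
qed

context utility
begin

text \<open>Write \<open>x - f u\<close> as the length of \<open>{f u<..x}\<close> and exchange the integrals over \<open>u\<close> and \<open>v\<close>: for fixed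
\<open>v\<close>, the condition \<open>f u < v\<close> says \<open>u < (s v / s x)\<^sup>\<theta>\<close>.\<close>

lemma average_eq_averaged_id:
  assumes "0 < x"
  shows "(\<integral>u. sinv (clip u powr (1 / \<theta>) * s x) \<partial>unif01) = averaged_id x"
proof -
  define f where "f u = sinv (clip u powr (1 / \<theta>) * s x)" for u
  have f_meas [measurable]: "f \<in> borel_measurable borel" by (simp add: f_def[abs_def])
  have sx: "0 < s x" using assms by (rule s_pos)
  have arg: "0 \<le> clip u powr (1 / \<theta>) * s x" "clip u powr (1 / \<theta>) * s x \<le> s x" for u
    using clip_powr_bounds[OF \<theta>_pos, of u] sx by (auto simp: mult_le_cancel_right1)
  have f: "0 \<le> f u" "f u \<le> x" for u
    using sinv_bounds[OF arg] assms by (auto simp: f_def)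
  have less: "emeasure unif01 {u. f u < v} = ennreal ((s v / s x) powr \<theta>)" if "0 \<le> v" "v \<le> x" for v
  proof -
    have "{u. f u < v} = {u. clip u powr (1 / \<theta>) < s v / s x}"
      using sinv_less_iff[OF arg, of v] assms that sx by (auto simp: f_def pos_less_divide_eq)
    moreover have "0 \<le> s v / s x" "s v / s x \<le> 1" using that sx s_nonneg s_le_iff[of v x] by auto
    ultimately show ?thesis using emeasure_unif01_clip_less[OF \<theta>_pos] by simp
  qed
  interpret pair_sigma_finite unif01 lborel by standard
  have "(\<integral>\<^sup>+u. ennreal (x - f u) \<partial>unif01) = (\<integral>\<^sup>+u. (\<integral>\<^sup>+v. (if f u < v \<and> v \<le> x then 1 else 0) \<partial>lborel) \<partial>unif01)"
  proof (intro nn_integral_cong)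
    fix u
    have "(\<integral>\<^sup>+v. (if f u < v \<and> v \<le> x then 1 else 0) \<partial>lborel) = (\<integral>\<^sup>+v. indicator {f u<..x} v \<partial>lborel)"
      by (intro nn_integral_cong) auto
    then show "ennreal (x - f u) = (\<integral>\<^sup>+v. (if f u < v \<and> v \<le> x then 1 else 0) \<partial>lborel)"
      using f by simp
  qed
  also have "\<dots> = (\<integral>\<^sup>+v. (\<integral>\<^sup>+u. (if f u < v \<and> v \<le> x then 1 else 0) \<partial>unif01) \<partial>lborel)"
    by (rule Fubini'[symmetric]) measurable
  also have "\<dots> = (\<integral>\<^sup>+v. ennreal ((if v \<in> {0..x} then (s (max 0 v) powr \<theta>) / s x powr \<theta> else 0)) \<partial>lborel)"
  proof (intro nn_integral_cong)
    fix v
    have "(\<integral>\<^sup>+u. (if f u < v \<and> v \<le> x then 1 else 0) \<partial>unif01)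
      = (\<integral>\<^sup>+u. indicator {u. f u < v \<and> v \<le> x} u \<partial>unif01)"
      by (intro nn_integral_cong) auto
    also have "\<dots> = emeasure unif01 {u. f u < v \<and> v \<le> x}" by simp
    also have "\<dots> = ennreal (if v \<in> {0..x} then (s (max 0 v) powr \<theta>) / s x powr \<theta> else 0)"
    proof (cases "0 \<le> v \<and> v \<le> x")
      case True
      then show ?thesis using less[of v] s_nonneg[of v] sx by (simp add: powr_divide)
    next
      case False
      then have "\<not> (f u < v \<and> v \<le> x)" for u using f(1)[of u] by linarith
      then have "{u. f u < v \<and> v \<le> x} = {}" by blast
      then show ?thesis using False by auto
    qed
    finally show "(\<integral>\<^sup>+u. (if f u < v \<and> v \<le> x then 1 else 0) \<partial>unif01)
       = ennreal (if v \<in> {0..x} then (s (max 0 v) powr \<theta>) / s x powr \<theta> else 0)" .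
  qed
  also have "\<dots> = ennreal (s_powr_integral x / s x powr \<theta>)"
  proof (rule nn_integral_has_integral_lborel)
    have "((\<lambda>v. s v powr \<theta>) has_integral s_powr_integral x) {0..x}"
      unfolding s_powr_integral_def using s_powr_integrable[of 0 x x] by (simp add: integrable_integral)
    then have "((\<lambda>v. s v powr \<theta> / s x powr \<theta>) has_integral s_powr_integral x / s x powr \<theta>) {0..x}"
      by (rule has_integral_divide)
    then have "((\<lambda>v. s (max 0 v) powr \<theta> / s x powr \<theta>) has_integral s_powr_integral x / s x powr \<theta>) {0..x}"
      by (rule has_integral_eq[rotated]) auto
    then show "((\<lambda>v. if v \<in> {0..x} then (s (max 0 v) powr \<theta>) / s x powr \<theta> else 0) has_integral s_powr_integral x / s x powr \<theta>) UNIV"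
      by (simp only: has_integral_restrict_UNIV)
  qed auto
  finally have "(\<integral>u. x - f u \<partial>unif01) = s_powr_integral x / s x powr \<theta>"
    using f s_powr_integral_diff_bounds(1)[of 0 x] assms by (subst integral_eq_nn_integral) (auto simp: s_powr_integral_def)
  moreover have "(\<integral>u. x - f u \<partial>unif01) = x - (\<integral>u. f u \<partial>unif01)"
  proof -
    have "integrable unif01 f" using f by (intro integrable_unif01_bounded[of _ x]) auto
    then show ?thesis by (simp add: unif01.prob_space)
  qed
  ultimately show ?thesis by (simp add: averaged_id_def f_def)
qed

text \<open>The transition map \<open>dickman_step\<close> with its arguments clipped to \<open>u \<in> {0..1}\<close> and \<open>x \<ge> 0\<close>, so that
neither the values of \<open>s\<close> at negative arguments nor arguments outside the range of \<open>s\<close> can enter.\<close>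

definition step :: "real \<Rightarrow> real \<Rightarrow> real" where
  "step u x = sinv (clip u powr (1 / \<theta>) * s (max 0 x + 1))"

lemma step_eq_dickman_step:
  "0 \<le> u \<Longrightarrow> u \<le> 1 \<Longrightarrow> 0 \<le> x \<Longrightarrow> dickman_step \<theta> s u x = step u x"
  by (simp add: step_def dickman_step_def)

lemma step_arg:
  "0 \<le> clip u powr (1 / \<theta>) * s (max 0 x + 1)" "clip u powr (1 / \<theta>) * s (max 0 x + 1) \<le> s (max 0 x + 1)"
proof -
  have "0 < s (max 0 x + 1)" by (rule s_pos) simp
  then show "0 \<le> clip u powr (1 / \<theta>) * s (max 0 x + 1)" "clip u powr (1 / \<theta>) * s (max 0 x + 1) \<le> s (max 0 x + 1)"
    using clip_powr_bounds[OF \<theta>_pos, of u] by (auto simp: mult_le_cancel_right1)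
qed

lemma step_bounds: "0 \<le> step u x" "step u x \<le> max 0 x + 1"
  using sinv_bounds[OF step_arg] by (auto simp: step_def)

lemma step_mono: "x \<le> y \<Longrightarrow> step u x \<le> step u y"
  unfolding step_def using clip_powr_bounds[OF \<theta>_pos, of u]
  by (intro sinv_mono[OF step_arg(1) _ step_arg(2)] mult_left_mono) (auto simp: s_le_iff)

lemma step_measurable [measurable]: "case_prod step \<in> borel_measurable (borel \<Otimes>\<^sub>M borel)"
proof -
  have "(\<lambda>(u, x). sinv (clip u powr (1 / \<theta>) * s (max 0 (max 0 x + 1)))) \<in> borel_measurable (borel \<Otimes>\<^sub>M borel)"
    by measurable
  then show ?thesis by (simp add: step_def[abs_def])
qed

lemma step_measurable_fst [measurable]: "(\<lambda>u. step u x) \<in> borel_measurable borel"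
  by (simp add: step_def[abs_def])

lemma step_integrable: "integrable unif01 (\<lambda>u. step u x)"
  using step_bounds[of _ x] by (intro integrable_unif01_bounded[of _ "max 0 x + 1"]) auto

lemma mean_step: "(\<integral>u. step u x \<partial>unif01) = averaged_id (max 0 x + 1)"
  unfolding step_def by (rule average_eq_averaged_id) auto

text \<open>As \<open>step u\<close> is monotone, the mean of \<open>|step u x - step u y|\<close> is the absolute value of a difference
of means, that is, of two values of the averaged identity at points to the right of \<open>1\<close>.\<close>

lemma step_contraction:
  assumes "sup_norm_pos (dickman_I \<theta> s) \<le> ereal \<rho>" "0 \<le> \<rho>"
  shows "(\<integral>u. \<bar>step u x - step u y\<bar> \<partial>unif01) \<le> \<rho> * \<bar>x - y\<bar>"
proof -
  have *: "(\<integral>u. \<bar>step u x - step u y\<bar> \<partial>unif01) \<le> \<rho> * \<bar>x - y\<bar>" if "y \<le> x" for x y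
  proof -
    have "(\<integral>u. \<bar>step u x - step u y\<bar> \<partial>unif01) = (\<integral>u. step u x - step u y \<partial>unif01)"
      using step_mono[OF that] by simp
    also have "\<dots> = averaged_id (max 0 x + 1) - averaged_id (max 0 y + 1)"
      using step_integrable by (simp add: mean_step)
    also have "\<dots> \<le> \<rho> * ((max 0 x + 1) - (max 0 y + 1))"
      using that by (intro averaged_id_increment_le assms) auto
    also have "\<dots> \<le> \<rho> * \<bar>x - y\<bar>" using assms(2) that by (intro mult_left_mono) auto
    finally show ?thesis .
  qed
  show ?thesis using *[of y x] *[of x y] by (cases "y \<le> x") (auto simp: abs_minus_commute)
qed

text \<open>Here the contraction holds for every single \<open>u\<close> with the factor \<open>u\<^bsup>1/\<theta>\<^esup>\<close>, whose mean is
\<open>\<theta> / (\<theta> + 1)\<close>.\<close>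

lemma step_contraction_lipschitz:
  assumes lip: "\<And>a x y. 0 \<le> a \<Longrightarrow> a \<le> 1 \<Longrightarrow> 1 \<le> x \<Longrightarrow> 1 \<le> y \<Longrightarrow> \<bar>sinv (a * s x) - sinv (a * s y)\<bar> \<le> a * \<bar>x - y\<bar>"
  shows "(\<integral>u. \<bar>step u x - step u y\<bar> \<partial>unif01) \<le> \<theta> / (\<theta> + 1) * \<bar>x - y\<bar>"
proof -
  have "(\<integral>u. \<bar>step u x - step u y\<bar> \<partial>unif01) \<le> (\<integral>u. clip u powr (1 / \<theta>) * \<bar>x - y\<bar> \<partial>unif01)"
  proof (rule integral_mono)
    show "integrable unif01 (\<lambda>u. \<bar>step u x - step u y\<bar>)" using step_integrable by auto
    show "integrable unif01 (\<lambda>u. clip u powr (1 / \<theta>) * \<bar>x - y\<bar>)"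
      using clip_powr_bounds[OF \<theta>_pos] by (intro integrable_mult_left integrable_unif01_bounded[of _ 1]) auto
    fix u
    have "\<bar>step u x - step u y\<bar> \<le> clip u powr (1 / \<theta>) * \<bar>(max 0 x + 1) - (max 0 y + 1)\<bar>"
      unfolding step_def using clip_powr_bounds[OF \<theta>_pos, of u] by (intro lip) auto
    also have "\<dots> \<le> clip u powr (1 / \<theta>) * \<bar>x - y\<bar>"
      using clip_powr_bounds[OF \<theta>_pos, of u] by (intro mult_left_mono) auto
    finally show "\<bar>step u x - step u y\<bar> \<le> clip u powr (1 / \<theta>) * \<bar>x - y\<bar>" .
  qed
  then show ?thesis by (simp add: integral_unif01_powr[OF \<theta>_pos])
qed

end

section \<open>The Wasserstein distance\<close>

lemma lipschitz_measurable: "L-lipschitz_on UNIV (h :: real \<Rightarrow> real) \<Longrightarrow> h \<in> borel_measurable borel"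
  by (intro borel_measurable_continuous_onI lipschitz_on_continuous_on)

lemma lipschitz_growth: "L-lipschitz_on UNIV (h :: real \<Rightarrow> real) \<Longrightarrow> \<bar>h x\<bar> \<le> \<bar>h 0\<bar> + L * \<bar>x\<bar>"
  using lipschitz_onD[of L UNIV h x 0] by (simp add: dist_real_def)

lemma integrable_lipschitz:
  assumes "prob_space \<mu>" and sets: "sets \<mu> = sets borel" and "integrable \<mu> (\<lambda>x. x)"
    and h: "L-lipschitz_on UNIV (h :: real \<Rightarrow> real)"
  shows "integrable \<mu> h"
proof -
  interpret prob_space \<mu> by fact
  have [measurable]: "h \<in> borel_measurable \<mu>"
    using lipschitz_measurable[OF h] measurable_cong_sets[OF sets refl] by blast
  show ?thesis
  proof (rule Bochner_Integration.integrable_bound)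
    show "integrable \<mu> (\<lambda>x. \<bar>h 0\<bar> + L * \<bar>x\<bar>)" using assms(3) by simp
    show "AE x in \<mu>. norm (h x) \<le> norm (\<bar>h 0\<bar> + L * \<bar>x\<bar>)"
    proof (rule AE_I2)
      fix x show "norm (h x) \<le> norm (\<bar>h 0\<bar> + L * \<bar>x\<bar>)"
        using lipschitz_growth[OF h, of x] lipschitz_on_nonneg[OF h] by simp
    qed
  qed fact
qed

lemma wasserstein1_commute: "wasserstein1 \<mu> \<nu> = wasserstein1 \<nu> \<mu>"
  by (simp add: wasserstein1_def abs_minus_commute)

lemma wasserstein1_triangle: "wasserstein1 \<mu> \<kappa> \<le> wasserstein1 \<mu> \<nu> + wasserstein1 \<nu> \<kappa>"
  unfolding wasserstein1_def[of \<mu> \<kappa>]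
proof (rule SUP_least)
  fix h :: "real \<Rightarrow> real" assume h: "h \<in> {h. 1-lipschitz_on UNIV h}"
  have "ennreal \<bar>(\<integral>x. h x \<partial>\<mu>) - (\<integral>x. h x \<partial>\<kappa>)\<bar>
      \<le> ennreal (\<bar>(\<integral>x. h x \<partial>\<mu>) - (\<integral>x. h x \<partial>\<nu>)\<bar> + \<bar>(\<integral>x. h x \<partial>\<nu>) - (\<integral>x. h x \<partial>\<kappa>)\<bar>)"
    by (intro ennreal_leI) linarith
  also have "\<dots> \<le> wasserstein1 \<mu> \<nu> + wasserstein1 \<nu> \<kappa>"
    unfolding wasserstein1_def using h by (subst ennreal_plus) (auto intro!: add_mono SUP_upper)
  finally show "ennreal \<bar>(\<integral>x. h x \<partial>\<mu>) - (\<integral>x. h x \<partial>\<kappa>)\<bar> \<le> wasserstein1 \<mu> \<nu> + wasserstein1 \<nu> \<kappa>" .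
qed

text \<open>Besides rescaling there is the case \<open>L = 0\<close>, where \<open>f\<close> is constant; it is needed for \<open>\<rho> = 0\<close>.\<close>

lemma lipschitz_integral_diff_le:
  assumes "prob_space \<mu>" "prob_space \<nu>" and f: "L-lipschitz_on UNIV f"
  shows "ennreal \<bar>(\<integral>x. f x \<partial>\<mu>) - (\<integral>x. f x \<partial>\<nu>)\<bar> \<le> ennreal L * wasserstein1 \<mu> \<nu>"
proof (cases "L = 0")
  case True
  then have "f x = f 0" for x using lipschitz_onD[OF f, of x 0] by simp
  then have "f = (\<lambda>_. f 0)" by auto
  then have "(\<integral>x. f x \<partial>\<mu>) = f 0" "(\<integral>x. f x \<partial>\<nu>) = f 0"
    using assms(1,2) by (metis lebesgue_integral_const prob_space.prob_space scaleR_one)+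
  then show ?thesis by simp
next
  case False
  then have L: "0 < L" using lipschitz_on_nonneg[OF f] by simp
  define h where "h x = f x / L" for x
  have "1-lipschitz_on UNIV h"
  proof (rule lipschitz_onI)
    fix x y
    have "\<bar>f x - f y\<bar> \<le> L * \<bar>x - y\<bar>" using lipschitz_onD[OF f, of x y] by (simp add: dist_real_def)
    then show "dist (h x) (h y) \<le> 1 * dist x y"
      using L by (simp add: dist_real_def h_def field_simps flip: diff_divide_distrib)
  qed simp
  then have "ennreal \<bar>(\<integral>x. h x \<partial>\<mu>) - (\<integral>x. h x \<partial>\<nu>)\<bar> \<le> wasserstein1 \<mu> \<nu>"
    unfolding wasserstein1_def by (intro SUP_upper) auto
  then have "ennreal L * ennreal \<bar>(\<integral>x. h x \<partial>\<mu>) - (\<integral>x. h x \<partial>\<nu>)\<bar> \<le> ennreal L * wasserstein1 \<mu> \<nu>"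
    by (intro mult_left_mono) auto
  moreover have "L * \<bar>(\<integral>x. h x \<partial>\<mu>) - (\<integral>x. h x \<partial>\<nu>)\<bar> = \<bar>(\<integral>x. f x \<partial>\<mu>) - (\<integral>x. f x \<partial>\<nu>)\<bar>"
    using L by (simp add: h_def[abs_def] abs_mult_pos' right_diff_distrib)
  ultimately show ?thesis using L by (simp add: ennreal_mult[symmetric])
qed

text \<open>The elementary half of Kantorovich duality: a 1-Lipschitz function cannot move \<open>X \<omega>\<close> and \<open>Y \<omega>\<close>
further apart.\<close>

lemma d1_le_coupling:
  assumes "prob_space M" and X: "integrable M X" and Y: "integrable M Y"
  shows "d1 M X M Y \<le> ennreal (\<integral>\<omega>. \<bar>X \<omega> - Y \<omega>\<bar> \<partial>M)"
  unfolding wasserstein1_def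
proof (rule SUP_least)
  interpret prob_space M by fact
  fix h :: "real \<Rightarrow> real" assume "h \<in> {h. 1-lipschitz_on UNIV h}"
  then have h: "1-lipschitz_on UNIV h" by simp
  have [measurable]: "h \<in> borel_measurable borel" using h by (rule lipschitz_measurable)
  note [measurable] = borel_measurable_integrable[OF X] borel_measurable_integrable[OF Y]
  have int: "integrable M (\<lambda>\<omega>. h (Z \<omega>))" if Z: "integrable M Z" for Z
  proof -
    note [measurable] = borel_measurable_integrable[OF Z]
    show ?thesis
    proof (rule Bochner_Integration.integrable_bound)
      show "integrable M (\<lambda>\<omega>. \<bar>h 0\<bar> + 1 * \<bar>Z \<omega>\<bar>)" using Z by simp
      show "AE \<omega> in M. norm (h (Z \<omega>)) \<le> norm (\<bar>h 0\<bar> + 1 * \<bar>Z \<omega>\<bar>)"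
      proof (rule AE_I2)
        fix \<omega> show "norm (h (Z \<omega>)) \<le> norm (\<bar>h 0\<bar> + 1 * \<bar>Z \<omega>\<bar>)"
          using lipschitz_growth[OF h, of "Z \<omega>"] by simp
      qed
    qed measurable
  qed
  have "\<bar>(\<integral>\<omega>. h (X \<omega>) \<partial>M) - (\<integral>\<omega>. h (Y \<omega>) \<partial>M)\<bar> = \<bar>\<integral>\<omega>. h (X \<omega>) - h (Y \<omega>) \<partial>M\<bar>"
    using int X Y by simp
  also have "\<dots> \<le> (\<integral>\<omega>. \<bar>h (X \<omega>) - h (Y \<omega>)\<bar> \<partial>M)" by (rule integral_abs_bound)
  also have "\<dots> \<le> (\<integral>\<omega>. \<bar>X \<omega> - Y \<omega>\<bar> \<partial>M)"
    using int X Y lipschitz_onD[OF h] by (intro integral_mono) (auto simp: dist_real_def)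
  finally show "ennreal \<bar>(\<integral>x. h x \<partial>distr M borel X) - (\<integral>x. h x \<partial>distr M borel Y)\<bar>
      \<le> ennreal (\<integral>\<omega>. \<bar>X \<omega> - Y \<omega>\<bar> \<partial>M)"
    by (intro ennreal_leI) (simp add: integral_distr)
qed

lemma wasserstein1_finite:
  assumes "prob_space \<mu>" "sets \<mu> = sets borel" "integrable \<mu> (\<lambda>x. x)"
    and "prob_space \<nu>" "sets \<nu> = sets borel" "integrable \<nu> (\<lambda>x. x)"
  shows "wasserstein1 \<mu> \<nu> < \<infinity>"
proof -
  have "wasserstein1 \<mu> \<nu> \<le> ennreal ((\<integral>x. \<bar>x\<bar> \<partial>\<mu>) + (\<integral>x. \<bar>x\<bar> \<partial>\<nu>))"
    unfolding wasserstein1_def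
  proof (rule SUP_least)
    fix h :: "real \<Rightarrow> real" assume "h \<in> {h. 1-lipschitz_on UNIV h}"
    then have h: "1-lipschitz_on UNIV h" by simp
    have *: "\<bar>(\<integral>x. h x \<partial>\<mu>) - h 0\<bar> \<le> (\<integral>x. \<bar>x\<bar> \<partial>\<mu>)"
      if "prob_space \<mu>" "sets \<mu> = sets borel" "integrable \<mu> (\<lambda>x. x)" for \<mu>
    proof -
      interpret prob_space \<mu> by fact
      have int: "integrable \<mu> h" using that h by (rule integrable_lipschitz)
      then have "(\<integral>x. h x \<partial>\<mu>) - h 0 = (\<integral>x. h x - h 0 \<partial>\<mu>)" by (simp add: prob_space)
      also have "\<bar>\<dots>\<bar> \<le> (\<integral>x. \<bar>h x - h 0\<bar> \<partial>\<mu>)" by (rule integral_abs_bound)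
      also have "\<dots> \<le> (\<integral>x. \<bar>x\<bar> \<partial>\<mu>)"
        using int that(3) lipschitz_onD[OF h, of _ 0] by (intro integral_mono) (auto simp: dist_real_def)
      finally show ?thesis .
    qed
    show "ennreal \<bar>(\<integral>x. h x \<partial>\<mu>) - (\<integral>x. h x \<partial>\<nu>)\<bar> \<le> ennreal ((\<integral>x. \<bar>x\<bar> \<partial>\<mu>) + (\<integral>x. \<bar>x\<bar> \<partial>\<nu>))"
      using *[OF assms(1-3)] *[OF assms(4-6)] by (intro ennreal_leI) linarith
  qed
  then show ?thesis by (simp add: le_less_trans)
qed

section \<open>Random maps acting on laws\<close>

abbreviation seq_space :: "(nat \<Rightarrow> real) measure" where "seq_space \<equiv> PiM UNIV (\<lambda>_. borel)"
abbreviation iid :: "(nat \<Rightarrow> real) measure" where "iid \<equiv> PiM UNIV (\<lambda>_. unif01)"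

definition advance :: "(real \<Rightarrow> real \<Rightarrow> real) \<Rightarrow> real measure \<Rightarrow> real measure" where
  "advance K \<mu> = distr (unif01 \<Otimes>\<^sub>M \<mu>) borel (case_prod K)"

text \<open>The bound on \<open>K\<close>, uniform in \<open>u\<close>, keeps means finite under \<open>advance K\<close> and makes every
expectation over \<open>u\<close> exist.\<close>

locale random_map =
  fixes K :: "real \<Rightarrow> real \<Rightarrow> real"
  assumes K_measurable [measurable]: "case_prod K \<in> borel_measurable (borel \<Otimes>\<^sub>M borel)"
    and K_bound: "\<And>u x. \<bar>K u x\<bar> \<le> \<bar>x\<bar> + 1"
begin

lemma K_measurable_fst [measurable]: "(\<lambda>u. K u x) \<in> borel_measurable borel"
proof -
  have "(\<lambda>u. (u, x)) \<in> borel \<rightarrow>\<^sub>M borel \<Otimes>\<^sub>M borel" by measurable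
  from measurable_compose[OF this K_measurable] show ?thesis by simp
qed

lemma K_integrable: "integrable unif01 (\<lambda>u. K u x)"
  using K_bound by (intro integrable_unif01_bounded[of _ "\<bar>x\<bar> + 1"]) auto

context
  fixes \<mu> :: "real measure"
  assumes prob: "prob_space \<mu>" and sets [measurable_cong]: "sets \<mu> = sets borel"
begin

lemma prob_space_advance: "prob_space (advance K \<mu>)"
proof -
  interpret \<mu>: prob_space \<mu> by (fact prob)
  interpret pair_prob_space unif01 \<mu> by standard
  show ?thesis unfolding advance_def by (intro prob_space_distr) measurable
qed

lemma integral_advance:
  assumes int: "integrable \<mu> (\<lambda>x. x)" and h: "L-lipschitz_on UNIV (h :: real \<Rightarrow> real)"
  shows "(\<integral>x. h x \<partial>advance K \<mu>) = (\<integral>x. (\<integral>u. h (K u x) \<partial>unif01) \<partial>\<mu>)"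
    and "integrable (advance K \<mu>) h"
proof -
  interpret \<mu>: prob_space \<mu> by (fact prob)
  interpret pair_prob_space unif01 \<mu> by standard
  have [measurable]: "h \<in> borel_measurable borel" using h by (rule lipschitz_measurable)
  have L: "0 \<le> L" using h by (rule lipschitz_on_nonneg)
  have "integrable (unif01 \<Otimes>\<^sub>M \<mu>) (\<lambda>p. snd p)"
  proof -
    interpret Q: pair_prob_space \<mu> unif01 by standard
    have "distr (unif01 \<Otimes>\<^sub>M \<mu>) \<mu> snd = \<mu>"
    proof (rule measure_eqI)
      fix A assume "A \<in> sets (distr (unif01 \<Otimes>\<^sub>M \<mu>) \<mu> snd)"
      then have A: "A \<in> sets \<mu>" by simp
      have "emeasure (distr (unif01 \<Otimes>\<^sub>M \<mu>) \<mu> snd) A = emeasure (unif01 \<Otimes>\<^sub>M \<mu>) (UNIV \<times> A)"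
        using A sets.sets_into_space[OF A]
        by (auto simp: emeasure_distr space_pair_measure intro!: arg_cong2[where f = emeasure])
      also have "\<dots> = emeasure \<mu> A"
        using A unif01.emeasure_space_1 by (subst \<mu>.emeasure_pair_measure_Times) auto
      finally show "emeasure (distr (unif01 \<Otimes>\<^sub>M \<mu>) \<mu> snd) A = emeasure \<mu> A" .
    qed simp
    then have "integrable (distr (unif01 \<Otimes>\<^sub>M \<mu>) \<mu> snd) (\<lambda>x. x)" using int by simp
    then show ?thesis by (subst (asm) integrable_distr_eq) auto
  qed
  then have bd: "integrable (unif01 \<Otimes>\<^sub>M \<mu>) (\<lambda>p. \<bar>h 0\<bar> + L * (\<bar>snd p\<bar> + 1))" by simp
  have le: "\<bar>h (K u x)\<bar> \<le> \<bar>h 0\<bar> + L * (\<bar>x\<bar> + 1)" for u x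
    by (rule order_trans[OF lipschitz_growth[OF h] add_left_mono[OF mult_left_mono[OF K_bound L]]])
  have hK: "integrable (unif01 \<Otimes>\<^sub>M \<mu>) (\<lambda>(u, x). h (K u x))"
  proof (rule Bochner_Integration.integrable_bound[OF bd])
    show "AE p in unif01 \<Otimes>\<^sub>M \<mu>. norm (case p of (u, x) \<Rightarrow> h (K u x)) \<le> norm (\<bar>h 0\<bar> + L * (\<bar>snd p\<bar> + 1))"
    proof (rule AE_I2, clarify)
      fix u x show "norm (h (K u x)) \<le> norm (\<bar>h 0\<bar> + L * (\<bar>snd (u, x)\<bar> + 1))"
        using le[of u x] L by simp
    qed
  qed measurable
  show "(\<integral>x. h x \<partial>advance K \<mu>) = (\<integral>x. (\<integral>u. h (K u x) \<partial>unif01) \<partial>\<mu>)"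
    using integral_snd[OF hK] unfolding advance_def by (subst integral_distr) (auto simp: case_prod_beta')
  show "integrable (advance K \<mu>) h"
    using hK unfolding advance_def by (subst integrable_distr_eq) (auto simp: case_prod_beta')
qed

lemma integral_advance_bounded:
  assumes [measurable]: "h \<in> borel_measurable borel" and bound: "\<And>x. \<bar>h x :: real\<bar> \<le> B"
  shows "(\<integral>x. h x \<partial>advance K \<mu>) = (\<integral>x. (\<integral>u. h (K u x) \<partial>unif01) \<partial>\<mu>)"
proof -
  interpret \<mu>: prob_space \<mu> by (fact prob)
  interpret pair_prob_space unif01 \<mu> by standard
  have hK: "integrable (unif01 \<Otimes>\<^sub>M \<mu>) (\<lambda>(u, x). h (K u x))"
    using bound by (intro P.integrable_const_bound[of _ B]) auto
  show ?thesis
    using integral_snd[OF hK] unfolding advance_def by (subst integral_distr) (auto simp: case_prod_beta')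
qed

lemma integrable_advance:
  assumes int: "integrable \<mu> (\<lambda>x. x)"
  shows "integrable (advance K \<mu>) (\<lambda>x. x)"
  by (rule integral_advance(2)[OF int, of 1]) (simp add: lipschitz_on_def)

end

text \<open>If \<open>h\<close> is 1-Lipschitz, then \<open>P x = E h (K U x)\<close> is \<open>L\<close>-Lipschitz, and integrating \<open>h\<close> after the step
is the same as integrating \<open>P\<close> before it.\<close>

lemma advance_contraction:
  assumes contr: "\<And>x y. (\<integral>u. \<bar>K u x - K u y\<bar> \<partial>unif01) \<le> L * \<bar>x - y\<bar>" and "0 \<le> L"
    and \<mu>: "prob_space \<mu>" "sets \<mu> = sets borel" "integrable \<mu> (\<lambda>x. x)"
    and \<nu>: "prob_space \<nu>" "sets \<nu> = sets borel" "integrable \<nu> (\<lambda>x. x)"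
  shows "wasserstein1 (advance K \<mu>) (advance K \<nu>) \<le> ennreal L * wasserstein1 \<mu> \<nu>"
  unfolding wasserstein1_def[of "advance K \<mu>"]
proof (rule SUP_least)
  fix h :: "real \<Rightarrow> real" assume "h \<in> {h. 1-lipschitz_on UNIV h}"
  then have h: "1-lipschitz_on UNIV h" by simp
  have [measurable]: "h \<in> borel_measurable borel" using h by (rule lipschitz_measurable)
  define P where "P x = (\<integral>u. h (K u x) \<partial>unif01)" for x
  have hK: "integrable unif01 (\<lambda>u. h (K u x))" for x
  proof (rule integrable_unif01_bounded[of _ "\<bar>h 0\<bar> + 1 * (\<bar>x\<bar> + 1)"])
    fix u show "\<bar>h (K u x)\<bar> \<le> \<bar>h 0\<bar> + 1 * (\<bar>x\<bar> + 1)"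
      by (rule order_trans[OF lipschitz_growth[OF h] add_left_mono[OF mult_left_mono[OF K_bound]]]) simp
  qed measurable
  have "L-lipschitz_on UNIV P"
  proof (rule lipschitz_onI)
    fix x y
    have "\<bar>P x - P y\<bar> = \<bar>\<integral>u. h (K u x) - h (K u y) \<partial>unif01\<bar>" using hK by (simp add: P_def)
    also have "\<dots> \<le> (\<integral>u. \<bar>h (K u x) - h (K u y)\<bar> \<partial>unif01)" by (rule integral_abs_bound)
    also have "\<dots> \<le> (\<integral>u. \<bar>K u x - K u y\<bar> \<partial>unif01)"
      using hK K_integrable lipschitz_onD[OF h] by (intro integral_mono) (auto simp: dist_real_def)
    also have "\<dots> \<le> L * \<bar>x - y\<bar>" by (rule contr)
    finally show "dist (P x) (P y) \<le> L * dist x y" by (simp add: dist_real_def)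
  qed fact
  then have "ennreal \<bar>(\<integral>x. P x \<partial>\<mu>) - (\<integral>x. P x \<partial>\<nu>)\<bar> \<le> ennreal L * wasserstein1 \<mu> \<nu>"
    by (rule lipschitz_integral_diff_le[OF \<mu>(1) \<nu>(1)])
  then show "ennreal \<bar>(\<integral>x. h x \<partial>advance K \<mu>) - (\<integral>x. h x \<partial>advance K \<nu>)\<bar> \<le> ennreal L * wasserstein1 \<mu> \<nu>"
    by (simp add: integral_advance(1)[OF \<mu> h] integral_advance(1)[OF \<nu> h] P_def)
qed

text \<open>The induction step for the joint law of the current state and all future innovations: consuming
one innovation leaves an independent i.i.d. sequence behind.\<close>

lemma advance_iid:
  assumes prob: "prob_space \<mu>" and sets [measurable_cong]: "sets \<mu> = sets borel"
  shows "distr (\<mu> \<Otimes>\<^sub>M iid) (borel \<Otimes>\<^sub>M seq_space) (\<lambda>(x, \<xi>). (K (\<xi> 0) x, \<lambda>k. \<xi> (Suc k))) = advance K \<mu> \<Otimes>\<^sub>M iid"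
    (is "?L = _")
proof (rule sym, rule pair_measure_eqI)
  interpret \<mu>: prob_space \<mu> by fact
  interpret R: prob_space iid by (intro prob_space_PiM prob_space_unif01)
  interpret sq: sequence_space unif01 by standard
  interpret UR: pair_prob_space unif01 iid by standard
  interpret UM: pair_prob_space unif01 \<mu> by standard
  interpret MR: pair_prob_space \<mu> iid by standard
  interpret adv: prob_space "advance K \<mu>" by (rule prob_space_advance[OF prob sets])
  show "sigma_finite_measure (advance K \<mu>)" "sigma_finite_measure iid" by unfold_locales
  have sets_iid [measurable_cong]: "sets iid = sets seq_space" by (intro sets_PiM_cong) auto
  have sets_adv [measurable_cong]: "sets (advance K \<mu>) = sets borel" by (simp add: advance_def)
  show "sets (advance K \<mu> \<Otimes>\<^sub>M iid) = sets ?L"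
    using sets_iid by (simp add: advance_def cong: sets_pair_measure_cong)
  fix A B assume A: "A \<in> sets (advance K \<mu>)" and B: "B \<in> sets iid"
  have A' [measurable]: "A \<in> sets borel" using A by (simp add: advance_def)
  have B' [measurable]: "B \<in> sets seq_space" using B sets_iid by simp
  define T where "T \<xi> = (\<lambda>k. \<xi> (Suc k))" for \<xi> :: "nat \<Rightarrow> real"
  have T_iid [measurable]: "T \<in> iid \<rightarrow>\<^sub>M iid"
    unfolding T_def by (rule measurable_abs_UNIV) measurable
  then have T_seq: "T \<in> iid \<rightarrow>\<^sub>M seq_space" using measurable_cong_sets[OF refl sets_iid] by blast
  have K0 [measurable]: "(\<lambda>p. K (snd p 0) (fst p)) \<in> borel_measurable (\<mu> \<Otimes>\<^sub>M iid)" by measurable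
  have shift: "(\<lambda>p. (K (snd p 0) (fst p), T (snd p))) \<in> \<mu> \<Otimes>\<^sub>M iid \<rightarrow>\<^sub>M borel \<Otimes>\<^sub>M seq_space"
    by (intro measurable_Pair K0 measurable_compose[OF measurable_snd T_seq])
  have L: "?L = distr (\<mu> \<Otimes>\<^sub>M iid) (borel \<Otimes>\<^sub>M seq_space) (\<lambda>p. (K (snd p 0) (fst p), T (snd p)))"
    by (simp add: T_def case_prod_beta')
  have m1: "(\<lambda>p. indicator A (K (snd p 0) (fst p)) * indicator B (T (snd p)) :: ennreal) \<in> borel_measurable (\<mu> \<Otimes>\<^sub>M iid)"
    using B by measurable
  have m2: "(\<lambda>\<xi>. indicator A (K (\<xi> 0) x) * indicator B (T \<xi>) :: ennreal) \<in> borel_measurable iid" for x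
    using B by measurable
  have m3: "(\<lambda>p. indicator A (K (fst p) x) * indicator B (snd p) :: ennreal) \<in> borel_measurable (unif01 \<Otimes>\<^sub>M iid)" for x
    using B by measurable
  have m4: "(\<lambda>p. indicator A (K (fst p) (snd p)) :: ennreal) \<in> borel_measurable (unif01 \<Otimes>\<^sub>M \<mu>)"
    by measurable
  have cn: "(\<lambda>(s, \<omega>). case_nat s \<omega>) \<in> unif01 \<Otimes>\<^sub>M iid \<rightarrow>\<^sub>M iid" by measurable
  have "emeasure ?L (A \<times> B) = (\<integral>\<^sup>+p. indicator (A \<times> B) p \<partial>?L)"
    using A' B' by (intro nn_integral_indicator[symmetric]) auto
  also have "\<dots> = (\<integral>\<^sup>+p. indicator (A \<times> B) (K (snd p 0) (fst p), T (snd p)) \<partial>(\<mu> \<Otimes>\<^sub>M iid))"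
    unfolding L using A' B' by (intro nn_integral_distr shift) auto
  also have "\<dots> = (\<integral>\<^sup>+p. indicator A (K (snd p 0) (fst p)) * indicator B (T (snd p)) \<partial>(\<mu> \<Otimes>\<^sub>M iid))"
    by (simp add: indicator_times)
  also have "\<dots> = (\<integral>\<^sup>+x. (\<integral>\<^sup>+\<xi>. indicator A (K (\<xi> 0) x) * indicator B (T \<xi>) \<partial>iid) \<partial>\<mu>)"
    using R.nn_integral_fst[OF m1] by simp
  also have "\<dots> = (\<integral>\<^sup>+x. (\<integral>\<^sup>+u. indicator A (K u x) \<partial>unif01) * emeasure iid B \<partial>\<mu>)"
  proof (intro nn_integral_cong)
    fix x
    have "(\<integral>\<^sup>+\<xi>. indicator A (K (\<xi> 0) x) * indicator B (T \<xi>) \<partial>iid)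
      = (\<integral>\<^sup>+\<xi>. indicator A (K (\<xi> 0) x) * indicator B (T \<xi>) \<partial>distr (unif01 \<Otimes>\<^sub>M iid) iid (\<lambda>(s, \<omega>). case_nat s \<omega>))"
      \<comment> \<open>An i.i.d. sequence is one uniform variable followed by an independent i.i.d. sequence.\<close>
      by (simp only: sq.PiM_iter)
    also have "\<dots> = (\<integral>\<^sup>+p. indicator A (K (fst p) x) * indicator B (snd p) \<partial>(unif01 \<Otimes>\<^sub>M iid))"
      using m2 by (subst nn_integral_distr[OF cn]) (simp_all add: case_prod_beta T_def)
    also have "\<dots> = (\<integral>\<^sup>+u. (\<integral>\<^sup>+\<xi>. indicator A (K u x) * indicator B \<xi> \<partial>iid) \<partial>unif01)"
      using R.nn_integral_fst[OF m3] by simp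
    also have "\<dots> = (\<integral>\<^sup>+u. indicator A (K u x) * emeasure iid B \<partial>unif01)"
      using B by (simp add: nn_integral_cmult)
    also have "\<dots> = (\<integral>\<^sup>+u. indicator A (K u x) \<partial>unif01) * emeasure iid B"
      by (intro nn_integral_multc) measurable
    finally show "(\<integral>\<^sup>+\<xi>. indicator A (K (\<xi> 0) x) * indicator B (T \<xi>) \<partial>iid)
      = (\<integral>\<^sup>+u. indicator A (K u x) \<partial>unif01) * emeasure iid B" .
  qed
  also have "\<dots> = (\<integral>\<^sup>+x. (\<integral>\<^sup>+u. indicator A (K u x) \<partial>unif01) \<partial>\<mu>) * emeasure iid B"
    by (intro nn_integral_multc) measurable
  also have "(\<integral>\<^sup>+x. (\<integral>\<^sup>+u. indicator A (K u x) \<partial>unif01) \<partial>\<mu>) = (\<integral>\<^sup>+p. indicator A (K (fst p) (snd p)) \<partial>(unif01 \<Otimes>\<^sub>M \<mu>))"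
    using UM.nn_integral_snd[OF m4] by simp
  also have "\<dots> = (\<integral>\<^sup>+x. indicator A x \<partial>advance K \<mu>)"
    unfolding advance_def by (subst nn_integral_distr) (measurable, simp add: case_prod_beta)
  also have "\<dots> = emeasure (advance K \<mu>) A" using A by simp
  finally show "emeasure (advance K \<mu>) A * emeasure iid B = emeasure ?L (A \<times> B)" ..
qed

end

text \<open>Banach's argument: \<open>d \<mu> \<pi> \<le> d \<mu> (A \<mu>) + d (A \<mu>) (A \<pi>) \<le> d (A \<mu>) \<mu> + L * d \<mu> \<pi>\<close> with \<open>A = advance K\<close>. The
finite means ensure that \<open>d \<mu> \<pi>\<close> is finite and may be moved to the left-hand side.\<close>

lemma (in random_map) fixed_point_bound:
  assumes contr: "\<And>x y. (\<integral>u. \<bar>K u x - K u y\<bar> \<partial>unif01) \<le> L * \<bar>x - y\<bar>" and L: "0 \<le> L" "L < 1"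
    and \<mu>: "prob_space \<mu>" "sets \<mu> = sets borel" "integrable \<mu> (\<lambda>x. x)"
    and \<pi>: "prob_space \<pi>" "sets \<pi> = sets borel" "integrable \<pi> (\<lambda>x. x)" "advance K \<pi> = \<pi>"
  shows "wasserstein1 \<mu> \<pi> \<le> ennreal (inverse (1 - L)) * wasserstein1 (advance K \<mu>) \<mu>"
proof -
  have A\<mu>: "prob_space (advance K \<mu>)" "sets (advance K \<mu>) = sets borel" "integrable (advance K \<mu>) (\<lambda>x. x)"
    using prob_space_advance[OF \<mu>(1,2)] integrable_advance[OF \<mu>] by (simp_all add: advance_def)
  obtain a where a: "wasserstein1 \<mu> \<pi> = ennreal a" "0 \<le> a"
    using wasserstein1_finite[OF \<mu> \<pi>(1-3)] by (cases "wasserstein1 \<mu> \<pi>") auto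
  obtain b where b: "wasserstein1 (advance K \<mu>) \<mu> = ennreal b" "0 \<le> b"
    using wasserstein1_finite[OF A\<mu> \<mu>] by (cases "wasserstein1 (advance K \<mu>) \<mu>") auto
  have "wasserstein1 \<mu> \<pi> \<le> wasserstein1 \<mu> (advance K \<mu>) + wasserstein1 (advance K \<mu>) (advance K \<pi>)"
    using wasserstein1_triangle \<pi>(4) by metis
  also have "\<dots> \<le> wasserstein1 (advance K \<mu>) \<mu> + ennreal L * wasserstein1 \<mu> \<pi>"
    using advance_contraction[OF contr L(1) \<mu> \<pi>(1-3)]
    by (intro add_mono) (simp_all add: wasserstein1_commute)
  finally have "ennreal a \<le> ennreal (b + L * a)"
    using a b L by (simp add: ennreal_mult ennreal_plus)
  then have "a \<le> b + L * a" using a b L by (subst (asm) ennreal_le_iff) auto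
  then have "a \<le> inverse (1 - L) * b" using L by (simp add: field_simps)
  then show ?thesis using a b L by (simp add: ennreal_mult[symmetric] ennreal_leI)
qed

section \<open>The law of the chain\<close>

text \<open>The two vimage algebras consist of the events \<open>X \<in> A\<close> and \<open>Y \<in> B\<close>, so their independence is the
product formula on measurable rectangles, which determine a measure on the product. The value types
may differ: below, a number is paired with a sequence.\<close>

lemma (in prob_space) pair_law_of_indep_set:
  assumes X [measurable]: "X \<in> M \<rightarrow>\<^sub>M S" and Y [measurable]: "Y \<in> M \<rightarrow>\<^sub>M T"
    and indep: "indep_set (sets (vimage_algebra (space M) X S)) (sets (vimage_algebra (space M) Y T))"
  shows "distr M S X \<Otimes>\<^sub>M distr M T Y = distr M (S \<Otimes>\<^sub>M T) (\<lambda>\<omega>. (X \<omega>, Y \<omega>))"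
proof (rule pair_measure_eqI)
  show "sigma_finite_measure (distr M S X)" "sigma_finite_measure (distr M T Y)"
    by (intro prob_space_imp_sigma_finite prob_space_distr X Y)+
  fix A B assume "A \<in> sets (distr M S X)" "B \<in> sets (distr M T Y)"
  then have A [measurable]: "A \<in> sets S" and B [measurable]: "B \<in> sets T" by simp_all
  let ?A = "X -` A \<inter> space M" and ?B = "Y -` B \<inter> space M"
  have "prob (?A \<inter> ?B) = prob ?A * prob ?B"
    by (intro indep_setD[OF indep] in_vimage_algebra A B)
  then have "emeasure M (?A \<inter> ?B) = emeasure M ?A * emeasure M ?B"
    by (simp add: emeasure_eq_measure ennreal_mult)
  moreover have "(\<lambda>\<omega>. (X \<omega>, Y \<omega>)) -` (A \<times> B) \<inter> space M = ?A \<inter> ?B" by auto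
  ultimately show "emeasure (distr M S X) A * emeasure (distr M T Y) B
      = emeasure (distr M (S \<Otimes>\<^sub>M T) (\<lambda>\<omega>. (X \<omega>, Y \<omega>))) (A \<times> B)"
    by (simp add: emeasure_distr)
qed (simp cong: sets_pair_measure_cong)

context utility
begin

sublocale random_map step
proof
  show "\<bar>step u x\<bar> \<le> \<bar>x\<bar> + 1" for u x using step_bounds[of u x] by auto
qed (rule step_measurable)

lemma AE_unif01_fst:
  assumes "prob_space N"
  shows "AE p in unif01 \<Otimes>\<^sub>M N. 0 \<le> fst p \<and> fst p \<le> 1"
proof (rule AE_distrD[of fst _ unif01])
  show "AE u in distr (unif01 \<Otimes>\<^sub>M N) unif01 fst. 0 \<le> u \<and> u \<le> 1"
    unfolding prob_space.distr_pair_fst[OF assms] by (rule AE_unif01)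
qed simp

lemma advance_distr:
  assumes "prob_space N" and D [measurable]: "D \<in> borel_measurable N" and nn: "\<And>\<omega>. \<omega> \<in> space N \<Longrightarrow> 0 \<le> D \<omega>"
  shows "distr (unif01 \<Otimes>\<^sub>M N) borel (\<lambda>(u, \<omega>). dickman_step \<theta> s u (D \<omega>)) = advance step (distr N borel D)"
proof -
  interpret N: prob_space N by fact
  interpret pair_prob_space unif01 N by standard
  have "distr unif01 unif01 (\<lambda>u. u) \<Otimes>\<^sub>M distr N borel D
      = distr (unif01 \<Otimes>\<^sub>M N) (unif01 \<Otimes>\<^sub>M borel) (\<lambda>(u, \<omega>). (u, D \<omega>))"
    by (intro pair_measure_distr prob_space_imp_sigma_finite N.prob_space_distr) auto
  then have "advance step (distr N borel D)
      = distr (distr (unif01 \<Otimes>\<^sub>M N) (unif01 \<Otimes>\<^sub>M borel) (\<lambda>(u, \<omega>). (u, D \<omega>))) borel (case_prod step)"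
    by (simp add: advance_def)
  also have "\<dots> = distr (unif01 \<Otimes>\<^sub>M N) borel (\<lambda>(u, \<omega>). step u (D \<omega>))"
    by (subst distr_distr) (auto simp: comp_def case_prod_beta')
  also have "\<dots> = distr (unif01 \<Otimes>\<^sub>M N) borel (\<lambda>(u, \<omega>). dickman_step \<theta> s u (D \<omega>))"
  proof (rule distr_cong_AE)
    show "AE p in unif01 \<Otimes>\<^sub>M N. (case p of (u, \<omega>) \<Rightarrow> step u (D \<omega>)) = (case p of (u, \<omega>) \<Rightarrow> dickman_step \<theta> s u (D \<omega>))"
      using AE_unif01_fst[OF \<open>prob_space N\<close>] AE_space
    proof eventually_elim
      case (elim p)
      then show ?case using step_eq_dickman_step[of "fst p" "D (snd p)"] nn[of "snd p"]
        by (auto simp: space_pair_measure case_prod_beta')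
    qed
    have "(\<lambda>p. sinv (fst p powr (1 / \<theta>) * s (max 0 (max 0 (D (snd p)) + 1)))) \<in> borel_measurable (unif01 \<Otimes>\<^sub>M N)"
      by measurable
    then show "(\<lambda>(u, \<omega>). dickman_step \<theta> s u (D \<omega>)) \<in> borel_measurable (unif01 \<Otimes>\<^sub>M N)"
      by (rule measurable_cong[THEN iffD1, rotated])
        (auto simp: dickman_step_def space_pair_measure nn max_def)
  qed (auto simp: case_prod_beta')
  finally show ?thesis ..
qed

lemma dickman_law_fixed_point:
  assumes "has_dickman_law \<theta> s N D"
  shows "advance step (distr N borel D) = distr N borel D"
  using assms advance_distr[of N D] by (auto simp: has_dickman_law_def)

context
  fixes M :: "'a measure" and U W :: "nat \<Rightarrow> 'a \<Rightarrow> real"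
  assumes chain: "dickman_chain \<theta> s M U W"
begin

interpretation M: prob_space M using chain by (simp add: dickman_chain_def)

lemma U_measurable: "U n \<in> borel_measurable M"
  using chain by (auto simp: dickman_chain_def M.indep_vars_def)

lemma U_law: "distr M borel (U n) = unif01"
  using chain by (simp add: dickman_chain_def)

lemma W_Suc: "\<omega> \<in> space M \<Longrightarrow> W (Suc n) \<omega> = dickman_step \<theta> s (U n \<omega>) (W n \<omega>)"
  using chain by (simp add: dickman_chain_def)

lemma AE_U: "AE \<omega> in M. 0 \<le> U n \<omega> \<and> U n \<omega> \<le> 1"
proof (rule AE_distrD[of "U n" _ borel])
  show "AE u in distr M borel (U n). 0 \<le> u \<and> u \<le> 1" unfolding U_law by (rule AE_unif01)
qed (rule U_measurable)

text \<open>On a null set the innovation may lie outside \<open>{0..1}\<close>, and then the next state can be the constant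
value of \<open>sinv\<close> off the range of \<open>s\<close>. That value may be negative, where \<open>s\<close> is unconstrained and
possibly not measurable; but it is the only such value, so \<open>s (W n + 1)\<close> is measurable all the same.\<close>

lemma W_range:
  assumes "\<omega> \<in> space M"
  shows "0 \<le> W n \<omega> \<or> W n \<omega> = sinv (-1)"
proof (cases n)
  case 0
  then show ?thesis using chain assms by (auto simp: dickman_chain_def)
next
  case (Suc m)
  define y where "y = U m \<omega> powr (1 / \<theta>) * s (W m \<omega> + 1)"
  have "W n \<omega> = sinv y" using W_Suc[OF assms] by (simp add: Suc dickman_step_def y_def)
  then show ?thesis using sinv_outside[of y] by (cases "y \<in> s ` {0..}") auto
qed

lemma W_measurable: "W n \<in> borel_measurable M"
proof (induction n)
  case 0
  then show ?case using chain by (simp add: dickman_chain_def)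
next
  case (Suc n)
  note Suc [measurable] U_measurable [measurable]
  have "(\<lambda>\<omega>. sinv (U n \<omega> powr (1 / \<theta>) * (if W n \<omega> = sinv (-1) then s (sinv (-1) + 1) else s (max 0 (max 0 (W n \<omega>) + 1)))))
      \<in> borel_measurable M" by measurable
  moreover have "W (Suc n) \<omega> = sinv (U n \<omega> powr (1 / \<theta>) * (if W n \<omega> = sinv (-1) then s (sinv (-1) + 1) else s (max 0 (max 0 (W n \<omega>) + 1))))"
    if "\<omega> \<in> space M" for \<omega>
    using W_Suc[OF that] W_range[OF that, of n] by (auto simp: dickman_step_def max_def)
  ultimately show ?case by (subst measurable_cong) auto
qed

lemma AE_W_nonneg: "AE \<omega> in M. 0 \<le> W n \<omega>"
proof (induction n)
  case 0
  then show ?case using chain by (auto simp: dickman_chain_def)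
next
  case (Suc n)
  then show ?case using AE_U[of n] AE_space
    by eventually_elim (simp add: W_Suc step_eq_dickman_step step_bounds)
qed

lemma AE_W_Suc: "AE \<omega> in M. W (Suc n) \<omega> = step (U n \<omega>) (W n \<omega>)"
  using AE_W_nonneg[of n] AE_U[of n] AE_space
  by eventually_elim (simp add: W_Suc step_eq_dickman_step)

lemma W_integrable: "integrable M (W n)"
proof (induction n)
  case 0
  then show ?case using chain by (simp add: dickman_chain_def)
next
  case (Suc n)
  show ?case
  proof (rule Bochner_Integration.integrable_bound)
    show "integrable M (\<lambda>\<omega>. \<bar>W n \<omega>\<bar> + 1)" using Suc by simp
    show "AE \<omega> in M. norm (W (Suc n) \<omega>) \<le> norm (\<bar>W n \<omega>\<bar> + 1)"
      using AE_W_Suc[of n] by eventually_elim (simp add: K_bound)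
  qed (rule W_measurable)
qed

text \<open>Independence of \<open>W n\<close> and \<open>U n\<close> is obtained from a stronger statement that is inductive: the state
\<open>W n\<close> is independent of the whole remaining sequence of innovations, which is i.i.d.\<close>

abbreviation joint_law :: "nat \<Rightarrow> (real \<times> (nat \<Rightarrow> real)) measure" where
  "joint_law n \<equiv> distr M (borel \<Otimes>\<^sub>M seq_space) (\<lambda>\<omega>. (W n \<omega>, \<lambda>k. U (n + k) \<omega>))"

lemma measurable_tail: "(\<lambda>\<omega>. (W n \<omega>, \<lambda>k. U (m + k) \<omega>)) \<in> M \<rightarrow>\<^sub>M borel \<Otimes>\<^sub>M seq_space"
  by (intro measurable_Pair measurable_abs_UNIV W_measurable U_measurable)

lemma joint_law_0: "joint_law 0 = distr M borel (W 0) \<Otimes>\<^sub>M iid"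
proof -
  have U_seq: "(\<lambda>\<omega> k. U k \<omega>) \<in> M \<rightarrow>\<^sub>M seq_space" by (intro measurable_abs_UNIV U_measurable)
  have "distr M seq_space (\<lambda>\<omega> k. U k \<omega>) = iid"
  proof -
    have "M.indep_vars (\<lambda>_. borel) U UNIV" using chain by (simp add: dickman_chain_def)
    then show ?thesis
      by (subst (asm) M.indep_vars_iff_distr_eq_PiM) (simp_all add: U_law restrict_UNIV U_measurable)
  qed
  moreover have "distr M borel (W 0) \<Otimes>\<^sub>M distr M seq_space (\<lambda>\<omega> k. U k \<omega>) = joint_law 0"
    unfolding add_0 by (rule M.pair_law_of_indep_set)
      (use chain U_seq W_measurable[of 0] in \<open>auto simp: dickman_chain_def\<close>)
  ultimately show ?thesis by simp
qed

lemma joint_law_step: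
  assumes IH: "joint_law n = distr M borel (W n) \<Otimes>\<^sub>M iid"
  shows "distr M borel (W (Suc n)) = advance step (distr M borel (W n))"
    and "joint_law (Suc n) = distr M borel (W (Suc n)) \<Otimes>\<^sub>M iid"
proof -
  \<comment> \<open>The chain driven by the sequence: one step of the state and a shift of the innovations.\<close>
  define \<Phi> where "\<Phi> p = (step (snd p 0) (fst p), \<lambda>k. snd p (Suc k))" for p :: "real \<times> (nat \<Rightarrow> real)"
  have \<Phi>: "\<Phi> \<in> borel \<Otimes>\<^sub>M seq_space \<rightarrow>\<^sub>M borel \<Otimes>\<^sub>M seq_space"
    unfolding \<Phi>_def by (intro measurable_Pair measurable_abs_UNIV) measurable
  have "joint_law (Suc n)
     = distr M (borel \<Otimes>\<^sub>M seq_space) (\<lambda>\<omega>. \<Phi> (W n \<omega>, \<lambda>k. U (n + k) \<omega>))"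
  proof (rule distr_cong_AE)
    show "AE \<omega> in M. (W (Suc n) \<omega>, \<lambda>k. U (Suc n + k) \<omega>) = \<Phi> (W n \<omega>, \<lambda>k. U (n + k) \<omega>)"
      using AE_W_Suc[of n] by eventually_elim (simp add: \<Phi>_def)
    show "(\<lambda>\<omega>. \<Phi> (W n \<omega>, \<lambda>k. U (n + k) \<omega>)) \<in> M \<rightarrow>\<^sub>M borel \<Otimes>\<^sub>M seq_space"
      by (rule measurable_compose[OF measurable_tail \<Phi>])
  qed (rule measurable_tail refl)+
  also have "\<dots> = distr (distr M borel (W n) \<Otimes>\<^sub>M iid) (borel \<Otimes>\<^sub>M seq_space) \<Phi>"
    unfolding IH[symmetric] by (subst distr_distr[OF \<Phi> measurable_tail]) (simp add: comp_def)
  also have "\<dots> = advance step (distr M borel (W n)) \<Otimes>\<^sub>M iid"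
    using advance_iid[OF M.prob_space_distr[OF W_measurable] sets_distr, of n] by (simp add: \<Phi>_def[abs_def] case_prod_beta')
  finally have *: "joint_law (Suc n) = advance step (distr M borel (W n)) \<Otimes>\<^sub>M iid" .
  interpret R: prob_space iid by (intro prob_space_PiM prob_space_unif01)
  have "distr M borel (W (Suc n)) = distr (joint_law (Suc n)) borel fst"
    by (subst distr_distr[OF _ measurable_tail]) (auto simp: comp_def)
  also have "\<dots> = distr (advance step (distr M borel (W n)) \<Otimes>\<^sub>M iid) (advance step (distr M borel (W n))) fst"
    unfolding * by (intro distr_cong) (auto simp: advance_def)
  also have "\<dots> = advance step (distr M borel (W n))" by (rule R.distr_pair_fst)
  finally show law: "distr M borel (W (Suc n)) = advance step (distr M borel (W n))" .
  show "joint_law (Suc n) = distr M borel (W (Suc n)) \<Otimes>\<^sub>M iid" using * by (simp only: law)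
qed

lemma joint_law_eq: "joint_law n = distr M borel (W n) \<Otimes>\<^sub>M iid"
  by (induction n) (rule joint_law_0, erule joint_law_step(2))

lemma chain_law: "distr M borel (W (Suc n)) = advance step (distr M borel (W n))"
  by (rule joint_law_step(1)[OF joint_law_eq])

end
end

context utility
begin

context
  fixes M :: "'a measure" and U W :: "nat \<Rightarrow> 'a \<Rightarrow> real" and L :: real
  assumes chain: "dickman_chain \<theta> s M U W"
    and contr: "\<And>x y. (\<integral>u. \<bar>step u x - step u y\<bar> \<partial>unif01) \<le> L * \<bar>x - y\<bar>" and L_nonneg: "0 \<le> L"
begin

lemma chain_law_finite_mean:
  "prob_space (distr M borel (W n))" "integrable (distr M borel (W n)) (\<lambda>x. x)"
proof -
  interpret M: prob_space M using chain by (simp add: dickman_chain_def)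
  note [measurable] = W_measurable[OF chain]
  show "prob_space (distr M borel (W n))" by (rule M.prob_space_distr) measurable
  show "integrable (distr M borel (W n)) (\<lambda>x. x)"
    using W_integrable[OF chain, of n] by (simp add: integrable_distr_eq)
qed

lemma d1_chain_fixed_point:
  assumes "L < 1" and D: "has_dickman_law \<theta> s N D" "integrable N D"
  shows "d1 M (W n) N D \<le> ennreal (inverse (1 - L)) * d1 M (W (Suc n)) M (W n)"
proof -
  interpret N: prob_space N using D by (simp add: has_dickman_law_def)
  have [measurable]: "D \<in> borel_measurable N" using D by (simp add: has_dickman_law_def)
  have "wasserstein1 (distr M borel (W n)) (distr N borel D)
    \<le> ennreal (inverse (1 - L)) * wasserstein1 (advance step (distr M borel (W n))) (distr M borel (W n))"
    using D by (intro fixed_point_bound contr L_nonneg assms(1) chain_law_finite_mean N.prob_space_distr dickman_law_fixed_point)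
      (simp_all add: integrable_distr_eq)
  then show ?thesis by (simp only: chain_law[OF chain])
qed

lemma d1_chain_geometric:
  "d1 M (W (Suc n)) M (W n) \<le> ennreal (L ^ n) * d1 M (W 1) M (W 0)"
proof (induction n)
  case (Suc n)
  have "d1 M (W (Suc (Suc n))) M (W (Suc n)) = wasserstein1 (advance step (distr M borel (W (Suc n)))) (advance step (distr M borel (W n)))"
    by (simp only: chain_law[OF chain])
  also have "\<dots> \<le> ennreal L * d1 M (W (Suc n)) M (W n)"
    by (intro advance_contraction contr L_nonneg chain_law_finite_mean) simp_all
  also have "\<dots> \<le> ennreal L * (ennreal (L ^ n) * d1 M (W 1) M (W 0))"
    using Suc by (rule mult_left_mono) simp
  also have "\<dots> = ennreal (L ^ Suc n) * d1 M (W 1) M (W 0)"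
    using L_nonneg by (simp add: ennreal_mult mult.assoc)
  finally show ?case .
qed simp

end

lemma d1_first_step_from_0:
  assumes chain: "dickman_chain \<theta> s M U W" and W0: "AE \<omega> in M. W 0 \<omega> = 0"
  shows "d1 M (W 1) M (W 0) \<le> ennreal (\<integral>u. sinv (u powr (1 / \<theta>)) \<partial>unif01)"
proof -
  interpret M: prob_space M using chain by (simp add: dickman_chain_def)
  note [measurable] = W_measurable[OF chain] U_measurable[OF chain]
  have "d1 M (W 1) M (W 0) \<le> ennreal (\<integral>\<omega>. \<bar>W 1 \<omega> - W 0 \<omega>\<bar> \<partial>M)"
    by (rule d1_le_coupling[OF M.prob_space_axioms W_integrable[OF chain] W_integrable[OF chain]])
  also have "(\<integral>\<omega>. \<bar>W 1 \<omega> - W 0 \<omega>\<bar> \<partial>M) = (\<integral>\<omega>. sinv (U 0 \<omega> powr (1 / \<theta>)) \<partial>M)"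
  proof (rule integral_cong_AE)
    show "AE \<omega> in M. \<bar>W 1 \<omega> - W 0 \<omega>\<bar> = sinv (U 0 \<omega> powr (1 / \<theta>))"
      using W0 AE_U[OF chain, of 0] AE_W_nonneg[OF chain, of 1] AE_space
    proof eventually_elim
      case (elim \<omega>)
      then show ?case using W_Suc[OF chain, of \<omega> 0] by (simp add: dickman_step_def s_1)
    qed
  qed measurable
  also have "\<dots> = (\<integral>u. sinv (u powr (1 / \<theta>)) \<partial>distr M borel (U 0))"
    by (subst integral_distr) auto
  finally show ?thesis by (simp only: U_law[OF chain])
qed

end

section \<open>The generalized Dickman law\<close>

lemma utility_id: "0 < \<theta> \<Longrightarrow> utility \<theta> (\<lambda>x. x)"
proof
  have "abs_cont_on_interval a b (\<lambda>x. x)" for a b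
    unfolding abs_cont_on_interval_def
  proof (intro allI impI)
    fix \<epsilon> :: real assume "0 < \<epsilon>"
    have "(\<Sum>(u, v)\<in>P. \<bar>v - u\<bar>) = (\<Sum>(u, v)\<in>P. v - u)" if "\<forall>(u, v)\<in>P. a \<le> u \<and> u < v \<and> v \<le> b" for P
      using that by (intro sum.cong) auto
    then show "\<exists>\<delta>>0. \<forall>P. finite P \<and> (\<forall>(u, v)\<in>P. a \<le> u \<and> u < v \<and> v \<le> b) \<and>
        disjoint_family_on (\<lambda>(u, v). {u<..<v}) P \<and> (\<Sum>(u, v)\<in>P. v - u) < \<delta> \<longrightarrow> (\<Sum>(u, v)\<in>P. \<bar>v - u\<bar>) < \<epsilon>"
      using \<open>0 < \<epsilon>\<close> by (intro exI[of _ \<epsilon>]) auto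
  qed
  then show "dickman_utility (\<lambda>x. x)"
    by (auto simp: dickman_utility_def locally_abs_cont_def strict_mono_on_def)
qed

lemma inv_into_id: "0 \<le> (y :: real) \<Longrightarrow> inv_into {0..} (\<lambda>x. x) y = y"
  by (rule inv_into_f_f[of "\<lambda>x. x"]) auto

text \<open>Stationarity alone forces the mean to be finite. With \<open>\<kappa> = E U\<^bsup>1/\<theta>\<^esup>\<close>, the truncation \<open>min D B\<close> has
the same mean as \<open>min (U\<^bsup>1/\<theta>\<^esup> (D + 1)) B\<close>. Bounding the latter by \<open>\<kappa> (D + 1)\<close> where \<open>D \<le> B\<close> and by
\<open>B\<close> elsewhere gives \<open>(1 - \<kappa>) E[D; D \<le> B] \<le> \<kappa>\<close>, uniformly in \<open>B\<close>.\<close>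

lemma generalized_dickman_finite_mean:
  assumes "0 < \<theta>" and D: "has_generalized_dickman_law \<theta> N D"
  shows "integrable N D"
proof -
  interpret N: prob_space N using D unfolding has_generalized_dickman_law_def by blast
  have [measurable]: "D \<in> borel_measurable N" and D_nn: "\<And>\<omega>. \<omega> \<in> space N \<Longrightarrow> 0 \<le> D \<omega>"
    and D_eq: "distr N borel D = distr (unif01 \<Otimes>\<^sub>M N) borel (\<lambda>(u, \<omega>). u powr (1 / \<theta>) * (D \<omega> + 1))"
    using D unfolding has_generalized_dickman_law_def by blast+
  interpret utility \<theta> "\<lambda>x. x" by (rule utility_id) fact
  define \<pi> where "\<pi> = distr N borel D"
  have \<pi>: "prob_space \<pi>" "sets \<pi> = sets borel"
    unfolding \<pi>_def by (auto intro: N.prob_space_distr)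
  interpret \<pi>: prob_space \<pi> by fact
  note \<pi>(2)[measurable_cong]
  have stat: "advance step \<pi> = \<pi>"
  proof -
    have "advance step \<pi> = distr (unif01 \<Otimes>\<^sub>M N) borel (\<lambda>(u, \<omega>). dickman_step \<theta> (\<lambda>x. x) u (D \<omega>))"
      unfolding \<pi>_def by (rule advance_distr[symmetric, OF N.prob_space_axioms]) (auto simp: D_nn)
    also have "\<dots> = distr (unif01 \<Otimes>\<^sub>M N) borel (\<lambda>(u, \<omega>). u powr (1 / \<theta>) * (D \<omega> + 1))"
      by (intro distr_cong refl) (auto simp: dickman_step_def space_pair_measure D_nn intro!: inv_into_id)
    also have "\<dots> = \<pi>" unfolding \<pi>_def D_eq[symmetric] ..
    finally show ?thesis .
  qed
  define \<kappa> where "\<kappa> = \<theta> / (\<theta> + 1)"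
  have \<kappa>: "0 < \<kappa>" "\<kappa> < 1" using \<open>0 < \<theta>\<close> by (auto simp: \<kappa>_def)
  have step_eq: "step u x = clip u powr (1 / \<theta>) * (max 0 x + 1)" for u x
    unfolding step_def using clip_powr_bounds[OF \<open>0 < \<theta>\<close>, of u] by (intro inv_into_id) auto
  have trunc: "(\<integral>x. max 0 x * indicator {..B} x \<partial>\<pi>) \<le> \<kappa> / (1 - \<kappa>)" if "0 \<le> B" for B
  proof -
    \<comment> \<open>\<open>\<psi> x\<close> bounds the mean of the truncated state after one step from \<open>x\<close>; beyond \<open>B\<close> it agrees
      with the truncation itself, so that large values cancel in the comparison.\<close>
    define \<psi> where "\<psi> x = (if x \<le> B then \<kappa> * (max 0 x + 1) else B)" for x
    have [measurable]: "\<psi> \<in> borel_measurable borel" by (simp add: \<psi>_def[abs_def])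
    have int: "integrable \<pi> (\<lambda>x. min (max 0 x) B)" "integrable \<pi> \<psi>"
        "integrable \<pi> (\<lambda>x. max 0 x * indicator {..B} x)" "integrable \<pi> (\<lambda>x. \<kappa> * indicator {..B} x)"
      using \<open>0 \<le> B\<close> \<kappa> by (auto intro!: \<pi>.integrable_const_bound[of _ "B + \<kappa> * (B + 1) + 1"]
          simp: \<psi>_def indicator_def mult_left_mono add_nonneg_nonneg add_increasing add_increasing2)
    have "(\<integral>x. min (max 0 x) B \<partial>\<pi>) = (\<integral>x. min (max 0 x) B \<partial>advance step \<pi>)" by (simp only: stat)
    also have "\<dots> = (\<integral>x. (\<integral>u. min (max 0 (step u x)) B \<partial>unif01) \<partial>\<pi>)"
      using \<open>0 \<le> B\<close> by (intro integral_advance_bounded[OF \<pi>, of _ B]) auto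
    also have "\<dots> \<le> (\<integral>x. \<psi> x \<partial>\<pi>)"
    proof (rule integral_mono')
      show "integrable \<pi> \<psi>" by (fact int)
      fix x
      show "(\<integral>u. min (max 0 (step u x)) B \<partial>unif01) \<le> \<psi> x"
      proof (cases "x \<le> B")
        case True
        have "(\<integral>u. min (max 0 (step u x)) B \<partial>unif01) \<le> (\<integral>u. step u x \<partial>unif01)"
          using \<open>0 \<le> B\<close> step_bounds[of _ x]
          by (intro integral_mono step_integrable integrable_unif01_bounded[of _ B]) (auto simp: min_def)
        also have "\<dots> = \<kappa> * (max 0 x + 1)"
          unfolding step_eq by (simp add: integral_unif01_powr[OF \<open>0 < \<theta>\<close>] \<kappa>_def)
        finally show ?thesis using True by (simp add: \<psi>_def)
      next
        case False
        have "(\<integral>u. min (max 0 (step u x)) B \<partial>unif01) \<le> (\<integral>u. B \<partial>unif01)"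
          using \<open>0 \<le> B\<close> by (intro integral_mono integrable_unif01_bounded[of _ B]) auto
        then show ?thesis using False by (simp add: \<psi>_def unif01.prob_space)
      qed
      show "0 \<le> \<psi> x" using \<kappa> \<open>0 \<le> B\<close> by (simp add: \<psi>_def)
    qed
    finally have "0 \<le> (\<integral>x. \<psi> x - min (max 0 x) B \<partial>\<pi>)" using int by simp
    also have "\<dots> = (\<integral>x. \<kappa> * indicator {..B} x - (1 - \<kappa>) * (max 0 x * indicator {..B} x) \<partial>\<pi>)"
      using \<open>0 \<le> B\<close> by (intro Bochner_Integration.integral_cong) (auto simp: \<psi>_def indicator_def algebra_simps)
    also have "\<dots> = \<kappa> * measure \<pi> {..B} - (1 - \<kappa>) * (\<integral>x. max 0 x * indicator {..B} x \<partial>\<pi>)"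
      using int by simp
    also have "\<dots> \<le> \<kappa> - (1 - \<kappa>) * (\<integral>x. max 0 x * indicator {..B} x \<partial>\<pi>)"
      using \<kappa> \<pi>.prob_le_1[of "{..B}"] by simp
    finally show ?thesis using \<kappa> by (simp add: field_simps)
  qed
  have "(\<lambda>n. \<integral>\<^sup>+x. ennreal (max 0 x * indicator {..real n} x) \<partial>\<pi>) \<longlonglongrightarrow> (\<integral>\<^sup>+x. ennreal (max 0 x) \<partial>\<pi>)"
  proof (rule nn_integral_LIMSEQ)
    show "incseq (\<lambda>n x. ennreal (max 0 x * indicator {..real n} x))"
      by (auto simp: incseq_def le_fun_def indicator_def)
    fix x :: real
    obtain m where "x \<le> real m" using real_arch_simple by blast
    then have "\<forall>\<^sub>F n in sequentially. ennreal (max 0 x * indicator {..real n} x) = ennreal (max 0 x)"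
      by (intro eventually_sequentiallyI[of m]) (auto simp: indicator_def)
    then show "(\<lambda>n. ennreal (max 0 x * indicator {..real n} x)) \<longlonglongrightarrow> ennreal (max 0 x)"
      by (rule tendsto_eventually)
  qed measurable
  moreover have "(\<integral>\<^sup>+x. ennreal (max 0 x * indicator {..real n} x) \<partial>\<pi>) \<le> ennreal (\<kappa> / (1 - \<kappa>))" for n
  proof -
    have "integrable \<pi> (\<lambda>x. max 0 x * indicator {..real n} x)"
      by (rule \<pi>.integrable_const_bound[of _ "real n"]) (auto simp: indicator_def)
    then show ?thesis using trunc[of "real n"] by (subst nn_integral_eq_integral) (auto intro: ennreal_leI)
  qed
  ultimately have "(\<integral>\<^sup>+x. ennreal (max 0 x) \<partial>\<pi>) \<le> ennreal (\<kappa> / (1 - \<kappa>))"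
    by (intro LIMSEQ_le_const2) auto
  then have "(\<integral>\<^sup>+x. ennreal (max 0 x) \<partial>\<pi>) < \<infinity>" by (simp add: le_less_trans)
  then have "integrable \<pi> (\<lambda>x. max 0 x)" by (intro integrableI_bounded) auto
  then have "integrable N (\<lambda>\<omega>. max 0 (D \<omega>))" by (simp add: \<pi>_def integrable_distr_eq)
  then show ?thesis
    by (subst Bochner_Integration.integrable_cong[OF refl, of _ _ "\<lambda>\<omega>. max 0 (D \<omega>)"]) (auto simp: D_nn)
qed

lemma generalized_dickman_law_imp_dickman_law:
  assumes "0 < \<theta>" and D: "has_generalized_dickman_law \<theta> N D"
  shows "has_dickman_law \<theta> (\<lambda>x. x) N D"
proof -
  have D_nn: "\<And>\<omega>. \<omega> \<in> space N \<Longrightarrow> 0 \<le> D \<omega>"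
    using D unfolding has_generalized_dickman_law_def by blast
  have "distr (unif01 \<Otimes>\<^sub>M N) borel (\<lambda>(u, \<omega>). dickman_step \<theta> (\<lambda>x. x) u (D \<omega>))
    = distr (unif01 \<Otimes>\<^sub>M N) borel (\<lambda>(u, \<omega>). u powr (1 / \<theta>) * (D \<omega> + 1))"
    by (intro distr_cong refl) (auto simp: dickman_step_def space_pair_measure D_nn intro!: inv_into_id)
  then show ?thesis
    using D generalized_dickman_finite_mean[OF assms]
    unfolding has_generalized_dickman_law_def has_dickman_law_def by metis
qed

section \<open>Distance of the chain to the Dickman law\<close>

theorem corollary3p2:
  fixes \<theta> :: real and M :: "'a measure" and N :: "'b measure"
  assumes "0 < \<theta>"
  shows
    "(\<forall>(s :: real \<Rightarrow> real) (U :: nat \<Rightarrow> 'a \<Rightarrow> real) (W :: nat \<Rightarrow> 'a \<Rightarrow> real) (D :: 'b \<Rightarrow> real) (\<rho> :: real).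
        dickman_utility s \<and> has_dickman_law \<theta> s N D \<and> integrable N D \<and>
        dickman_chain \<theta> s M U W \<and>
        0 \<le> \<rho> \<and> \<rho> < 1 \<and> sup_norm_pos (dickman_I \<theta> s) \<le> ereal \<rho>
        \<longrightarrow>
        (\<forall>n. d1 M (W n) N D \<le> ennreal (inverse (1 - \<rho>)) * d1 M (W (Suc n)) M (W n)) \<and>
        ((\<forall>a\<in>{0..1}. \<forall>x\<ge>1. \<forall>y\<ge>1.
            \<bar>inv_into {0..} s (a * s x) - inv_into {0..} s (a * s y)\<bar> \<le> a * \<bar>x - y\<bar>)
         \<longrightarrow>
         (\<forall>n. d1 M (W n) N D
            \<le> ennreal (inverse (1 - \<rho>) * (\<theta> / (\<theta> + 1)) ^ n) * d1 M (W 1) M (W 0)) \<and>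
         ((AE \<omega> in M. W 0 \<omega> = 0) \<longrightarrow>
          (\<forall>n. d1 M (W n) N D
            \<le> ennreal (inverse (1 - \<rho>) * (\<theta> / (\<theta> + 1)) ^ n
                        * (\<integral>u. inv_into {0..} s (u powr (1 / \<theta>)) \<partial>unif01)))))) \<and>
     (\<forall>(U :: nat \<Rightarrow> 'a \<Rightarrow> real) (W :: nat \<Rightarrow> 'a \<Rightarrow> real) (D :: 'b \<Rightarrow> real).
        has_generalized_dickman_law \<theta> N D \<and>
        dickman_chain \<theta> (\<lambda>x. x) M U W \<and> (AE \<omega> in M. W 0 \<omega> = 0)
        \<longrightarrow>
        (\<forall>n. d1 M (W n) N D \<le> ennreal (\<theta> * (\<theta> / (\<theta> + 1)) ^ n)))"
proof (intro conjI allI impI)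
  fix s :: "real \<Rightarrow> real" and U W :: "nat \<Rightarrow> 'a \<Rightarrow> real" and D :: "'b \<Rightarrow> real" and \<rho> :: real
  assume "dickman_utility s \<and> has_dickman_law \<theta> s N D \<and> integrable N D \<and>
    dickman_chain \<theta> s M U W \<and> 0 \<le> \<rho> \<and> \<rho> < 1 \<and> sup_norm_pos (dickman_I \<theta> s) \<le> ereal \<rho>"
  then have s: "dickman_utility s" and D: "has_dickman_law \<theta> s N D" "integrable N D"
    and chain: "dickman_chain \<theta> s M U W"
    and \<rho>: "0 \<le> \<rho>" "\<rho> < 1" "sup_norm_pos (dickman_I \<theta> s) \<le> ereal \<rho>" by blast+
  interpret utility \<theta> s by (rule utility.intro) fact+
  have step1: "d1 M (W n) N D \<le> ennreal (inverse (1 - \<rho>)) * d1 M (W (Suc n)) M (W n)" for n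
    by (rule d1_chain_fixed_point[OF chain step_contraction[OF \<rho>(3,1)] \<rho>(1,2) D])
  then show "d1 M (W n) N D \<le> ennreal (inverse (1 - \<rho>)) * d1 M (W (Suc n)) M (W n)" for n .
  assume lip: "\<forall>a\<in>{0..1}. \<forall>x\<ge>1. \<forall>y\<ge>1. \<bar>sinv (a * s x) - sinv (a * s y)\<bar> \<le> a * \<bar>x - y\<bar>"
  have \<kappa>: "0 \<le> \<theta> / (\<theta> + 1)" using assms by simp
  have contr: "(\<integral>u. \<bar>step u x - step u y\<bar> \<partial>unif01) \<le> \<theta> / (\<theta> + 1) * \<bar>x - y\<bar>" for x y
    by (rule step_contraction_lipschitz) (use lip in auto)
  have step2: "d1 M (W n) N D \<le> ennreal (inverse (1 - \<rho>) * (\<theta> / (\<theta> + 1)) ^ n) * d1 M (W 1) M (W 0)" for n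
  proof -
    have "d1 M (W n) N D \<le> ennreal (inverse (1 - \<rho>)) * (ennreal ((\<theta> / (\<theta> + 1)) ^ n) * d1 M (W 1) M (W 0))"
      using d1_chain_geometric[OF chain contr \<kappa>] by (intro order_trans[OF step1] mult_left_mono) simp_all
    then show ?thesis using \<rho> \<kappa> by (simp add: ennreal_mult mult.assoc)
  qed
  then show "d1 M (W n) N D \<le> ennreal (inverse (1 - \<rho>) * (\<theta> / (\<theta> + 1)) ^ n) * d1 M (W 1) M (W 0)" for n .
  assume W0: "AE \<omega> in M. W 0 \<omega> = 0"
  fix n
  have "d1 M (W n) N D \<le> ennreal (inverse (1 - \<rho>) * (\<theta> / (\<theta> + 1)) ^ n) * ennreal (\<integral>u. sinv (u powr (1 / \<theta>)) \<partial>unif01)"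
    by (intro order_trans[OF step2] mult_left_mono d1_first_step_from_0[OF chain W0]) simp
  then show "d1 M (W n) N D \<le> ennreal (inverse (1 - \<rho>) * (\<theta> / (\<theta> + 1)) ^ n * (\<integral>u. sinv (u powr (1 / \<theta>)) \<partial>unif01))"
    using \<rho> \<kappa> by (subst ennreal_mult') (auto intro!: mult_nonneg_nonneg zero_le_power)
next
  fix U W :: "nat \<Rightarrow> 'a \<Rightarrow> real" and D :: "'b \<Rightarrow> real" and n :: nat
  assume "has_generalized_dickman_law \<theta> N D \<and> dickman_chain \<theta> (\<lambda>x. x) M U W \<and> (AE \<omega> in M. W 0 \<omega> = 0)"
  then have D: "has_generalized_dickman_law \<theta> N D" and chain: "dickman_chain \<theta> (\<lambda>x. x) M U W"
    and W0: "AE \<omega> in M. W 0 \<omega> = 0" by blast+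
  interpret utility \<theta> "\<lambda>x. x" by (rule utility_id[OF assms])
  \<comment> \<open>For the identity the pointwise contraction factor plays both roles, that of \<open>\<rho>\<close> and that of the
    geometric rate.\<close>
  define \<kappa> where "\<kappa> = \<theta> / (\<theta> + 1)"
  have \<kappa>: "0 \<le> \<kappa>" "\<kappa> < 1" "inverse (1 - \<kappa>) * \<kappa> = \<theta>" using assms by (simp_all add: \<kappa>_def field_simps)
  have contr: "(\<integral>u. \<bar>step u x - step u y\<bar> \<partial>unif01) \<le> \<kappa> * \<bar>x - y\<bar>" for x y
    unfolding \<kappa>_def
    by (rule step_contraction_lipschitz) (simp add: inv_into_id flip: right_diff_distrib, simp add: abs_mult)
  have "(\<integral>u. sinv (u powr (1 / \<theta>)) \<partial>unif01) = \<kappa>"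
  proof -
    have "(\<integral>u. sinv (u powr (1 / \<theta>)) \<partial>unif01) = (\<integral>u. clip u powr (1 / \<theta>) \<partial>unif01)"
    proof (rule integral_cong_AE)
      show "AE u in unif01. sinv (u powr (1 / \<theta>)) = clip u powr (1 / \<theta>)"
        using AE_unif01 by eventually_elim (simp add: inv_into_id)
    qed measurable
    then show ?thesis by (simp add: integral_unif01_powr[OF assms] \<kappa>_def)
  qed
  then have first: "d1 M (W 1) M (W 0) \<le> ennreal \<kappa>"
    using d1_first_step_from_0[OF chain W0] by simp
  have "d1 M (W n) N D \<le> ennreal (inverse (1 - \<kappa>)) * d1 M (W (Suc n)) M (W n)"
    by (rule d1_chain_fixed_point[OF chain contr \<kappa>(1,2) generalized_dickman_law_imp_dickman_law[OF assms D]
        generalized_dickman_finite_mean[OF assms D]])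
  also have "\<dots> \<le> ennreal (inverse (1 - \<kappa>)) * (ennreal (\<kappa> ^ n) * ennreal \<kappa>)"
    by (intro mult_left_mono order_trans[OF d1_chain_geometric[OF chain contr \<kappa>(1)]] first) simp_all
  also have "\<dots> = ennreal (inverse (1 - \<kappa>) * \<kappa> * \<kappa> ^ n)"
    using \<kappa>(1,2) by (simp add: ennreal_mult[symmetric] mult.assoc mult.commute)
  also have "inverse (1 - \<kappa>) * \<kappa> * \<kappa> ^ n = \<theta> * (\<theta> / (\<theta> + 1)) ^ n"
    by (simp only: \<kappa>(3)) (simp only: \<kappa>_def)
  finally show "d1 M (W n) N D \<le> ennreal (\<theta> * (\<theta> / (\<theta> + 1)) ^ n)" .
qed

end
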